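(* For each integer $N\ge2$ let $F_N=F(a_1,\dots,a_N)$ be the free group with free basis $A=\{a_1,\dots,a_N\}$, and let \[ \rho_N:=\inf_{\phi\in\mathrm{Out}(F_N)}\frac{\lambda_A(\phi)}{\Lambda_A(\phi)} . \] Then $\lim_{N\to\infty}\rho_N=0$, and moreover $\rho_N=O(\frac1N)$, that is, $\limsup_{N\to\infty}N\rho_N<\infty$.
   Context: For $w\in F_N$, $\|w\|_A$ denotes the cyclically reduced length of $w$ over $A^{\pm1}$. It depends only on the conjugacy class of $w$, so $\|\phi(w)\|_A$ is well defined for $\phi\in\mathrm{Out}(F_N)$. The extremal stretching factor of $\phi\in\mathrm{Out}(F_N)$ with respect to $A$ is $\Lambda_A(\phi)=\sup_{w\in F_N\smallsetminus\{1\}}\frac{\|\phi(w)\|_A}{\|w\|_A}$. Consider the simple non-backtracking random walk on $F_N$ with respect to $A$. Its trajectories are semi-infinite freely reduced words $y_1y_2y_3\dots$ over $A^{\pm1}$, the first letter is uniform on $A^{\pm1}$, and each letter $x$ is followed by each $y\ne x^{-1}$ in $A^{\pm1}$ with probability $1/(2N-1)$. The generic stretching factor $\lambda_A(\phi)$ of $\phi$ with respect to $A$ is the number (which is known to exist) such that for a.e. trajectory $y_1y_2\dots$ one has $\lambda_A(\phi)=\lim_{n\to\infty}\frac{\|\phi(y_1\dots y_n)\|_A}{n}=\lim_{n\to\infty}\frac{\|\phi(y_1\dots y_n)\|_A}{\|y_1\dots y_n\|_A}$. *)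

theory Defs
  imports "HOL-Probability.Probability" "HOL-Algebra.Bij" "HOL-Algebra.Coset"
begin

section \<open>The free group of rank \<open>N\<close>\<close>

text \<open>The pair \<open>(i, True)\<close> stands for the basis element \<open>a\<^sub>i\<^sub>+\<^sub>1\<close>, the pair \<open>(i, False)\<close> for its
  inverse.\<close>

type_synonym letter = "nat \<times> bool"

definition linv :: "letter \<Rightarrow> letter" where
  "linv x = (fst x, \<not> snd x)"

definition letters :: "nat \<Rightarrow> letter set" where
  "letters N = {..<N} \<times> UNIV"

abbreviation reduced_word :: "letter list \<Rightarrow> bool" where
  "reduced_word \<equiv> successively (\<lambda>x y. y \<noteq> linv x)"

text \<open>\<open>push x w\<close> is the reduced form of \<open>x # w\<close> when \<open>w\<close> is reduced.\<close>

fun push :: "letter \<Rightarrow> letter list \<Rightarrow> letter list" where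
  "push x [] = [x]"
| "push x (y # ys) = (if y = linv x then ys else x # y # ys)"

definition free_reduce :: "letter list \<Rightarrow> letter list" where
  "free_reduce w = foldr push w []"

definition free_group :: "nat \<Rightarrow> letter list monoid" where
  "free_group N = \<lparr>carrier = {w \<in> lists (letters N). reduced_word w},
                   mult = (\<lambda>u v. free_reduce (u @ v)), one = []\<rparr>"

lemma linv_linv [simp]: "linv (linv x) = x"
  by (simp add: linv_def)

lemma linv_eq_iff [simp]: "linv x = linv y \<longleftrightarrow> x = y"
  by (auto simp: linv_def prod_eq_iff)

lemma linv_neq [simp]: "linv x \<noteq> x" "x \<noteq> linv x"
  by (auto simp: linv_def prod_eq_iff)

lemma linv_in_letters [simp]: "linv x \<in> letters N \<longleftrightarrow> x \<in> letters N"
  by (auto simp: linv_def letters_def mem_Times_iff)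

lemma finite_letters [simp]: "finite (letters N)"
  by (simp add: letters_def)

lemma reduced_push: "reduced_word w \<Longrightarrow> reduced_word (push x w)"
  by (cases "(x, w)" rule: push.cases) (auto simp: successively_Cons)

lemma push_lists: "x \<in> letters N \<Longrightarrow> w \<in> lists (letters N) \<Longrightarrow> push x w \<in> lists (letters N)"
  by (cases "(x, w)" rule: push.cases) auto

lemma push_linv: "reduced_word w \<Longrightarrow> push (linv x) (push x w) = w"
  by (cases w; cases "tl w") (auto simp: successively_Cons)

lemma push_linv': "reduced_word w \<Longrightarrow> push x (push (linv x) w) = w"
  using push_linv[of w "linv x"] by simp

lemma reduced_foldr_push: "reduced_word w \<Longrightarrow> reduced_word (foldr push u w)"
  by (induction u) (auto intro: reduced_push)

lemma reduced_free_reduce: "reduced_word (free_reduce w)"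
  by (simp add: free_reduce_def reduced_foldr_push)

lemma foldr_push_lists:
  "u \<in> lists (letters N) \<Longrightarrow> w \<in> lists (letters N) \<Longrightarrow> foldr push u w \<in> lists (letters N)"
proof (induction u)
  case (Cons x u)
  then have "x \<in> letters N" "foldr push u w \<in> lists (letters N)" by auto
  then show ?case using push_lists by simp
qed simp

lemma free_reduce_reduced: "reduced_word w \<Longrightarrow> free_reduce w = w"
proof (induction w)
  case (Cons x w)
  then have "free_reduce w = w" by (cases w) (auto simp: free_reduce_def)
  then show ?case using Cons.prems
    by (cases w) (auto simp: free_reduce_def)
qed (simp add: free_reduce_def)

lemma foldr_push_push:
  "reduced_word w \<Longrightarrow> foldr push (push x u) w = push x (foldr push u w)"
  by (cases "(x, u)" rule: push.cases) (auto simp: push_linv' reduced_foldr_push)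

lemma foldr_push_free_reduce:
  "reduced_word w \<Longrightarrow> foldr push (free_reduce u) w = foldr push u w"
  by (induction u) (auto simp: free_reduce_def foldr_push_push)

lemma free_reduce_append: "free_reduce (u @ v) = foldr push u (free_reduce v)"
  by (simp add: free_reduce_def)

lemma free_reduce_append_free_reduce [simp]:
  "free_reduce (free_reduce u @ v) = free_reduce (u @ v)"
  "free_reduce (u @ free_reduce v) = free_reduce (u @ v)"
  by (simp_all add: free_reduce_append foldr_push_free_reduce reduced_free_reduce
      free_reduce_reduced)

lemma free_reduce_inverse: "free_reduce (rev (map linv w) @ w) = []"
proof (induction w)
  case (Cons x w)
  have "free_reduce (rev (map linv (x # w)) @ x # w)
      = foldr push (rev (map linv w)) (push (linv x) (push x (free_reduce w)))"
    by (simp add: free_reduce_def)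
  also have "\<dots> = free_reduce (rev (map linv w) @ w)"
    by (simp add: push_linv reduced_free_reduce free_reduce_append)
  finally show ?case using Cons.IH by simp
qed (simp add: free_reduce_def)

lemma reduced_Cons: "reduced_word (x # w) \<Longrightarrow> reduced_word w"
  by (cases w) auto

lemma reduced_inverse: "reduced_word w \<Longrightarrow> reduced_word (rev (map linv w))"
  by (auto simp: successively_map elim!: successively_mono)

lemma group_free_group: "group (free_group N)"
proof (rule groupI)
  fix x y z assume "x \<in> carrier (free_group N)" "y \<in> carrier (free_group N)"
    "z \<in> carrier (free_group N)"
  then show "x \<otimes>\<^bsub>free_group N\<^esub> y \<in> carrier (free_group N)"
    using foldr_push_lists[of "x @ y" N "[]"]
    using reduced_free_reduce[of "x @ y"] by (simp add: free_group_def free_reduce_def)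
  show "(x \<otimes>\<^bsub>free_group N\<^esub> y) \<otimes>\<^bsub>free_group N\<^esub> z = x \<otimes>\<^bsub>free_group N\<^esub> (y \<otimes>\<^bsub>free_group N\<^esub> z)"
    by (simp add: free_group_def)
next
  fix x assume x: "x \<in> carrier (free_group N)"
  then show "\<one>\<^bsub>free_group N\<^esub> \<otimes>\<^bsub>free_group N\<^esub> x = x"
    by (simp add: free_group_def free_reduce_reduced)
  show "\<exists>y\<in>carrier (free_group N). y \<otimes>\<^bsub>free_group N\<^esub> x = \<one>\<^bsub>free_group N\<^esub>"
    by (rule bexI[of _ "rev (map linv x)"])
       (use x reduced_inverse[of x] in \<open>auto simp: free_group_def free_reduce_inverse\<close>)
qed (simp add: free_group_def)

lemma inv_free_group:
  "w \<in> carrier (free_group N) \<Longrightarrow> inv\<^bsub>free_group N\<^esub> w = rev (map linv w)"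
  using reduced_inverse[of w]
  by (intro group.inv_equality[OF group_free_group])
     (auto simp: free_group_def free_reduce_inverse)


section \<open>Cyclically reduced length\<close>

function cyc_core :: "letter list \<Rightarrow> letter list" where
  "cyc_core w = (if length w \<ge> 2 \<and> last w = linv (hd w) then cyc_core (butlast (tl w)) else w)"
  by auto
termination by (relation "Wellfounded.measure length") auto

declare cyc_core.simps [simp del]

definition cyc_len :: "letter list \<Rightarrow> nat" where
  "cyc_len w = length (cyc_core w)"

lemma cyc_core_conj: "cyc_core (x # w @ [linv x]) = cyc_core w"
  by (subst cyc_core.simps) auto

lemma foldr_push_single:
  "reduced_word w \<Longrightarrow>
   foldr push w [y] = (if w \<noteq> [] \<and> last w = linv y then butlast w else w @ [y])"
proof (induction w)
  case (Cons x w)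
  then have IH: "foldr push w [y] = (if w \<noteq> [] \<and> last w = linv y then butlast w else w @ [y])"
    using reduced_Cons by blast
  show ?case
  proof (cases w)
    case Nil then show ?thesis by (auto simp: linv_def prod_eq_iff)
  next
    case (Cons a w')
    then show ?thesis using IH Cons.prems by (cases w') auto
  qed
qed simp

lemma cyc_len_conj_letter:
  assumes "reduced_word w"
  shows "cyc_len (free_reduce (x # w @ [linv x])) = cyc_len w"
proof -
  have eq: "free_reduce (x # w @ [linv x])
      = push x (if w \<noteq> [] \<and> last w = x then butlast w else w @ [linv x])"
    using foldr_push_single[OF assms, of "linv x"] by (simp add: free_reduce_def)
  show ?thesis
  proof (cases w)
    case Nil then show ?thesis by (simp add: free_reduce_def)
  next
    case w: (Cons a m)
    consider "a = linv x" "last w = x" | "a = linv x" "last w \<noteq> x" | "a \<noteq> linv x" "last w = x"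
      | "a \<noteq> linv x" "last w \<noteq> x" by blast
    then show ?thesis
    proof cases
      case 1
      then have "m \<noteq> []" using w by auto
      then have m: "m = butlast m @ [x]" using 1 w by (metis append_butlast_last_id last_ConsR)
      have "cyc_core w = cyc_core (butlast m)"
        using cyc_core_conj[of "linv x" "butlast m"] m w 1 by simp
      then show ?thesis unfolding eq using 1 w \<open>m \<noteq> []\<close> by (simp add: cyc_len_def)
    next
      case 2
      have "cyc_core w = w" using 2 w by (subst cyc_core.simps) auto
      moreover have "cyc_core (m @ [linv x]) = m @ [linv x]"
        using assms 2 w by (subst cyc_core.simps) (cases m; auto)
      ultimately show ?thesis unfolding eq using 2 w by (auto simp: cyc_len_def)
    next
      case 3
      have "cyc_core w = w" using 3 w by (subst cyc_core.simps) auto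
      moreover have "push x (butlast w) = x # butlast w"
        using 3 w by (cases m) auto
      moreover have "cyc_core (x # butlast w) = x # butlast w"
      proof -
        have "\<not> (length (x # butlast w) \<ge> 2 \<and> last (x # butlast w) = linv x)"
        proof
          assume *: "length (x # butlast w) \<ge> 2 \<and> last (x # butlast w) = linv x"
          then have "butlast w \<noteq> []" by auto
          then have "w = butlast (butlast w) @ [linv x] @ [x]"
            using * 3 w by (metis append_assoc append_butlast_last_id last_ConsR list.distinct(1))
          then have "successively (\<lambda>x y. y \<noteq> linv x) (butlast (butlast w) @ [linv x] @ [x])"
            using assms by simp
          then show False by (simp add: successively_append_iff)
        qed
        then show ?thesis by (subst cyc_core.simps) auto
      qed
      ultimately show ?thesis unfolding eq using 3 w by (auto simp: cyc_len_def)
    next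
      case 4
      then show ?thesis unfolding eq using w cyc_core_conj[of x w] by (simp add: cyc_len_def)
    qed
  qed
qed

lemma cyc_len_conj:
  assumes "g \<in> carrier (free_group N)" "w \<in> carrier (free_group N)"
  shows "cyc_len (g \<otimes>\<^bsub>free_group N\<^esub> w \<otimes>\<^bsub>free_group N\<^esub> inv\<^bsub>free_group N\<^esub> g) = cyc_len w"
proof -
  have "cyc_len (free_reduce (g @ w @ rev (map linv g))) = cyc_len w" for g
  proof (induction g)
    case Nil
    then show ?case using assms(2) by (simp add: free_group_def free_reduce_reduced)
  next
    case (Cons x g)
    let ?v = "free_reduce (g @ w @ rev (map linv g))"
    have "free_reduce ((x # g) @ w @ rev (map linv (x # g)))
        = free_reduce (free_reduce ([x] @ ?v) @ [linv x])"
      by (simp only: free_reduce_append_free_reduce append_assoc)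
         (metis (no_types) append_assoc append_Cons append_Nil free_reduce_append_free_reduce
            list.simps(9) map_append rev.simps(2) list.simps(8))
    then show ?case
      using cyc_len_conj_letter[OF reduced_free_reduce] Cons.IH by simp
  qed
  from this[of g] show ?thesis
    by (simp add: inv_free_group[OF assms(1)]) (simp add: free_group_def)
qed


section \<open>Outer automorphisms\<close>

definition inner_auto :: "('a, 'b) monoid_scheme \<Rightarrow> 'a \<Rightarrow> 'a \<Rightarrow> 'a" where
  "inner_auto G g = (\<lambda>x\<in>carrier G. g \<otimes>\<^bsub>G\<^esub> x \<otimes>\<^bsub>G\<^esub> inv\<^bsub>G\<^esub> g)"

definition Inn :: "('a, 'b) monoid_scheme \<Rightarrow> ('a \<Rightarrow> 'a) set" where
  "Inn G = inner_auto G ` carrier G"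

definition Out :: "('a, 'b) monoid_scheme \<Rightarrow> ('a \<Rightarrow> 'a) set monoid" where
  "Out G = AutoGroup G Mod Inn G"

text \<open>An outer automorphism is a coset of automorphisms; the cyclically reduced length of the
  image of a word does not depend on the representative, see \<open>out_cyc_len_coset\<close>.\<close>

definition out_cyc_len :: "(letter list \<Rightarrow> letter list) set \<Rightarrow> letter list \<Rightarrow> nat" where
  "out_cyc_len \<phi> w = the_elem ((\<lambda>f. cyc_len (f w)) ` \<phi>)"

lemma (in group) inner_auto_closed:
  "g \<in> carrier G \<Longrightarrow> x \<in> carrier G \<Longrightarrow> inner_auto G g x \<in> carrier G"
  by (simp add: inner_auto_def)

lemma (in group) inner_auto_mult:
  assumes "g \<in> carrier G" "h \<in> carrier G"
  shows "inner_auto G (g \<otimes> h) = compose (carrier G) (inner_auto G g) (inner_auto G h)"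
  using assms by (auto simp: inner_auto_def compose_def inv_mult_group m_assoc fun_eq_iff)

lemma (in group) inner_auto_one: "inner_auto G \<one> = (\<lambda>x\<in>carrier G. x)"
  by (auto simp: inner_auto_def)

lemma (in group) inner_auto_in_auto:
  assumes g: "g \<in> carrier G"
  shows "inner_auto G g \<in> auto G"
proof -
  have inverse: "inner_auto G (inv h) (inner_auto G h x) = x"
    if "h \<in> carrier G" "x \<in> carrier G" for h x
    using inner_auto_mult[of "inv h" h] that
    by (simp add: inner_auto_one) (metis compose_eq restrict_apply)
  have "bij_betw (inner_auto G g) (carrier G) (carrier G)"
    by (rule bij_betw_byWitness[of _ "inner_auto G (inv g)"])
       (use g inverse[of g] inverse[of "inv g"] in \<open>auto simp: inner_auto_closed\<close>)
  moreover have "g \<otimes> (x \<otimes> y) \<otimes> inv g = g \<otimes> x \<otimes> inv g \<otimes> (g \<otimes> y \<otimes> inv g)"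
    if "x \<in> carrier G" "y \<in> carrier G" for x y
  proof -
    have "g \<otimes> x \<otimes> inv g \<otimes> (g \<otimes> y \<otimes> inv g) = g \<otimes> x \<otimes> (inv g \<otimes> g) \<otimes> y \<otimes> inv g"
      using g that by (simp only: m_assoc m_closed inv_closed)
    also have "\<dots> = g \<otimes> (x \<otimes> y) \<otimes> inv g"
      using g that by (simp add: l_inv m_assoc)
    finally show ?thesis by simp
  qed
  then have "inner_auto G g \<in> hom G G"
    using g by (simp add: hom_def inner_auto_def)
  ultimately show ?thesis
    by (simp add: auto_def Bij_def inner_auto_def)
qed

lemma (in group) mult_AutoGroup:
  "f \<in> auto G \<Longrightarrow> h \<in> auto G \<Longrightarrow> f \<otimes>\<^bsub>AutoGroup G\<^esub> h = compose (carrier G) f h"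
  by (simp add: AutoGroup_def BijGroup_def auto_def)

lemma (in group) normal_Inn: "Inn G \<lhd> AutoGroup G"
proof -
  interpret A: group "AutoGroup G" by (rule AutoGroup)
  have carrier: "carrier (AutoGroup G) = auto G" by (simp add: AutoGroup_def)
  have "inner_auto G \<in> hom G (AutoGroup G)"
    by (auto simp: hom_def carrier inner_auto_in_auto inner_auto_mult mult_AutoGroup)
  then interpret h: group_hom G "AutoGroup G" "inner_auto G"
    by unfold_locales
  have "f \<otimes>\<^bsub>AutoGroup G\<^esub> inner_auto G g \<otimes>\<^bsub>AutoGroup G\<^esub> inv\<^bsub>AutoGroup G\<^esub> f \<in> Inn G"
    if f: "f \<in> auto G" and g: "g \<in> carrier G" for f g
  proof -
    have hom: "group_hom G G f"
      using f by unfold_locales (simp add: auto_def)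
    have fg: "f g \<in> carrier G" using group_hom.hom_closed[OF hom g] .
    have "f \<otimes>\<^bsub>AutoGroup G\<^esub> inner_auto G g = inner_auto G (f g) \<otimes>\<^bsub>AutoGroup G\<^esub> f"
      using f g fg group_hom.hom_closed[OF hom] group_hom.hom_mult[OF hom] group_hom.hom_inv[OF hom]
      by (simp add: mult_AutoGroup inner_auto_in_auto)
         (auto simp: compose_def inner_auto_def fun_eq_iff)
    moreover have "f \<in> carrier (AutoGroup G)" "inner_auto G (f g) \<in> carrier (AutoGroup G)"
      using f inner_auto_in_auto[OF fg] by (simp_all only: carrier)
    ultimately have "f \<otimes>\<^bsub>AutoGroup G\<^esub> inner_auto G g \<otimes>\<^bsub>AutoGroup G\<^esub> inv\<^bsub>AutoGroup G\<^esub> f = inner_auto G (f g)"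
      by (simp only: A.m_assoc A.inv_closed A.r_inv A.r_one)
    then show ?thesis using fg by (simp only: Inn_def image_eqI)
  qed
  then have "\<forall>f\<in>carrier (AutoGroup G). \<forall>h\<in>Inn G.
      f \<otimes>\<^bsub>AutoGroup G\<^esub> h \<otimes>\<^bsub>AutoGroup G\<^esub> inv\<^bsub>AutoGroup G\<^esub> f \<in> Inn G"
    unfolding carrier Inn_def by blast
  moreover have "subgroup (Inn G) (AutoGroup G)"
    unfolding Inn_def by (rule h.img_is_subgroup)
  ultimately show ?thesis
    by (simp only: A.normal_inv_iff simp_thms)
qed

lemma out_cyc_len_coset:
  assumes f: "f \<in> auto (free_group N)" and w: "w \<in> carrier (free_group N)"
  shows "out_cyc_len (Inn (free_group N) #>\<^bsub>AutoGroup (free_group N)\<^esub> f) w = cyc_len (f w)"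
proof -
  interpret group "free_group N" by (rule group_free_group)
  have fw: "f w \<in> carrier (free_group N)"
    using f w by (auto simp: auto_def hom_def)
  have image_one: "cyc_len ((inner_auto (free_group N) g \<otimes>\<^bsub>AutoGroup (free_group N)\<^esub> f) w) = cyc_len (f w)"
    if g: "g \<in> carrier (free_group N)" for g
  proof -
    have "(inner_auto (free_group N) g \<otimes>\<^bsub>AutoGroup (free_group N)\<^esub> f) w
        = inner_auto (free_group N) g (f w)"
      using f w g by (simp only: mult_AutoGroup inner_auto_in_auto compose_eq)
    then show ?thesis
      using cyc_len_conj[OF g fw] fw by (simp only: inner_auto_def restrict_apply if_True)
  qed
  have "(\<lambda>h. cyc_len (h w)) ` (Inn (free_group N) #>\<^bsub>AutoGroup (free_group N)\<^esub> f)
      = (\<lambda>g. cyc_len ((inner_auto (free_group N) g \<otimes>\<^bsub>AutoGroup (free_group N)\<^esub> f) w))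
          ` carrier (free_group N)"
    unfolding r_coset_def Inn_def by blast
  also have "\<dots> = (\<lambda>g. cyc_len (f w)) ` carrier (free_group N)"
    by (rule image_cong[OF refl image_one])
  also have "\<dots> = {cyc_len (f w)}"
    using fw by (intro image_constant)
  finally show ?thesis by (simp add: out_cyc_len_def)
qed


section \<open>The simple non-backtracking random walk\<close>

text \<open>The law of the letter with index \<open>n\<close> given the trajectory \<open>y\<close> up to that index; indices start
  at \<open>0\<close>.\<close>

definition nbw_step :: "nat \<Rightarrow> nat \<Rightarrow> (nat \<Rightarrow> letter) \<Rightarrow> letter measure" where
  "nbw_step N n y =
     measure_pmf (pmf_of_set (if n = 0 then letters N else letters N - {linv (y (n - 1))}))"

text \<open>The Ionescu-Tulcea measure on infinite trajectories.\<close>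

definition nbw :: "nat \<Rightarrow> (nat \<Rightarrow> letter) measure" where
  "nbw N = projective_family.lim UNIV
     (Ionescu_Tulcea.CI (nbw_step N) (\<lambda>_. count_space UNIV)) (\<lambda>_. count_space UNIV)"

lemma Ionescu_Tulcea_nbw: "Ionescu_Tulcea (nbw_step N) (\<lambda>_. count_space UNIV)"
proof (rule Ionescu_Tulcea.intro)
  fix n
  show "nbw_step N n \<in> measurable (PiM {0..<n} (\<lambda>_. count_space UNIV)) (subprob_algebra (count_space UNIV))"
  proof (cases n)
    case 0
    then show ?thesis
      by (auto simp: nbw_step_def[abs_def] measure_pmf_in_subprob_algebra space_subprob_algebra
          intro!: measurable_const)
  next
    case (Suc m)
    have "(\<lambda>x. measure_pmf (pmf_of_set (letters N - {linv x})))
        \<in> measurable (count_space UNIV) (subprob_algebra (count_space UNIV))"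
      by (simp add: measure_pmf_in_subprob_algebra)
    moreover have "(\<lambda>y. y m) \<in> measurable (PiM {0..<n} (\<lambda>_. count_space UNIV :: letter measure)) (count_space UNIV)"
      using Suc by (intro measurable_component_singleton) auto
    ultimately show ?thesis
      using Suc by (auto simp: nbw_step_def[abs_def] intro: measurable_compose)
  qed
next
  show "prob_space (nbw_step N n y)" for n y
    by (simp add: nbw_step_def measure_pmf.prob_space_axioms)
qed

lemma prob_space_nbw: "prob_space (nbw N)"
proof -
  interpret Ionescu_Tulcea "nbw_step N" "\<lambda>_. count_space UNIV" by (rule Ionescu_Tulcea_nbw)
  have "prob_space (distr (nbw N) (PiM {} (\<lambda>_. count_space UNIV)) (\<lambda>x. restrict x {}))"
    using distr_lim[of "{}"] PF.prob_space_P[of "{}"] by (simp add: nbw_def)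
  then show ?thesis
    by (rule prob_space_distrD[rotated])
       (auto simp: nbw_def measurable_cong_sets[OF PF.sets_lim refl] intro!: measurable_restrict)
qed

section \<open>Stretching factors\<close>

text \<open>The supremum is finite, since \<open>cyc_len (f w)\<close> is at most the maximal length of the image of a
  letter times \<open>cyc_len w\<close>.\<close>

definition extremal_stretch :: "nat \<Rightarrow> (letter list \<Rightarrow> letter list) set \<Rightarrow> real" where
  "extremal_stretch N \<phi> =
     (SUP w\<in>carrier (free_group N) - {[]}. real (out_cyc_len \<phi> w) / real (cyc_len w))"

text \<open>\<open>map y [0..<n]\<close> is the initial segment of length \<open>n\<close> of the trajectory \<open>y\<close>; it is almost
  surely reduced.\<close>

definition generic_stretch :: "nat \<Rightarrow> (letter list \<Rightarrow> letter list) set \<Rightarrow> real" where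
  "generic_stretch N \<phi> = (THE l. AE y in nbw N.
     (\<lambda>n. real (out_cyc_len \<phi> (map y [0..<n])) / real n) \<longlonglongrightarrow> l \<and>
     (\<lambda>n. real (out_cyc_len \<phi> (map y [0..<n])) / real (cyc_len (map y [0..<n]))) \<longlonglongrightarrow> l)"

definition rho :: "nat \<Rightarrow> real" where
  "rho N = (INF \<phi>\<in>carrier (Out (free_group N)). generic_stretch N \<phi> / extremal_stretch N \<phi>)"

end

theory Submission
  imports Defs "HOL-Real_Asymp.Real_Asymp"
begin

text \<open>The transvection \<open>a\<^sub>1 \<mapsto> a\<^sub>1 a\<^sub>2\<^sup>N\<close> stretches \<open>a\<^sub>1\<close> by the factor \<open>N + 1\<close>, but a random word
  contains \<open>a\<^sub>1\<close> or its inverse with frequency \<open>1 / N\<close> only, so it is generically stretched by at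
  most \<open>2\<close>. Hence \<open>\<rho>\<^sub>N \<le> 2 / (N + 1)\<close>.

  Since \<open>generic_stretch\<close> is a definite description, \<open>\<rho>\<^sub>N \<ge> 0\<close> requires that the generic stretching
  factor of every outer automorphism exists. By bounded cancellation, the increments of the length
  of \<open>f (y\<^sub>1 \<dots> y\<^sub>n)\<close> depend only on the last few letters, so the length grows linearly by a strong
  law of large numbers for block functions of the walk. That law follows by removing the letters of
  the block one at a time: the difference between a block function and its conditional expectation
  given all but the last letter is a bounded martingale difference. Passing to cyclically reduced
  lengths costs at most a multiple of the overlap of the word with its inverse, which is almost
  surely logarithmic.\<close>

section \<open>Automorphisms of free groups and bounded cancellation\<close>

abbreviation word_inv :: "letter list \<Rightarrow> letter list" where
  "word_inv w \<equiv> rev (map linv w)"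

lemma carrier_free_group: "w \<in> carrier (free_group N) \<longleftrightarrow> w \<in> lists (letters N) \<and> reduced_word w"
  by (simp add: free_group_def)

lemma mult_free_group: "u \<otimes>\<^bsub>free_group N\<^esub> v = free_reduce (u @ v)"
  by (simp add: free_group_def)

lemma one_free_group: "\<one>\<^bsub>free_group N\<^esub> = []"
  by (simp add: free_group_def)

lemma carrier_appendD:
  assumes "u @ v \<in> carrier (free_group N)"
  shows "u \<in> carrier (free_group N)" "v \<in> carrier (free_group N)"
  using assms by (auto simp: carrier_free_group successively_append_iff)

lemma mult_eq_append:
  "u @ v \<in> carrier (free_group N) \<Longrightarrow> u \<otimes>\<^bsub>free_group N\<^esub> v = u @ v"
  by (simp add: mult_free_group carrier_free_group free_reduce_reduced)

lemma word_inv_carrier: "w \<in> carrier (free_group N) \<Longrightarrow> word_inv w \<in> carrier (free_group N)"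
  using reduced_inverse[of w] by (auto simp: carrier_free_group)

lemma length_free_reduce: "length (free_reduce w) \<le> length w"
proof (induction w)
  case (Cons x w)
  have "length (push x v) \<le> Suc (length v)" for v by (cases "(x, v)" rule: push.cases) auto
  then show ?case using Cons by (simp add: free_reduce_def) (meson le_trans Suc_le_mono)
qed (simp add: free_reduce_def)

lemma length_mult_free_group: "length (u \<otimes>\<^bsub>free_group N\<^esub> v) \<le> length u + length v"
  using length_free_reduce[of "u @ v"] by (simp add: mult_free_group)

text \<open>\<open>c\<close> is the maximal piece of \<open>g\<close> that cancels. The induction
  removes the last letter of \<open>g\<close>: either it cancels against the first letter of
  \<open>h\<close> and joins \<open>c\<close>, or the concatenation is already reduced.\<close>

lemma free_reduce_cancellation:
  assumes "reduced_word g" "reduced_word h"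
  shows "\<exists>a c b. g = a @ c \<and> h = word_inv c @ b \<and> free_reduce (g @ h) = a @ b"
  using assms
proof (induction g arbitrary: h rule: rev_induct)
  case Nil
  then show ?case by (auto simp: free_reduce_reduced)
next
  case (snoc x g)
  have red_g: "reduced_word g" using snoc.prems by (simp add: successively_append_iff)
  show ?case
  proof (cases "\<exists>h'. h = linv x # h'")
    case True
    then obtain h' where h': "h = linv x # h'" by blast
    have red: "reduced_word h'" using snoc.prems(2) reduced_Cons unfolding h' by blast
    obtain a c b where abc: "g = a @ c" "h' = word_inv c @ b" "free_reduce (g @ h') = a @ b"
      using snoc.IH[OF red_g red] by blast
    have "free_reduce ((g @ [x]) @ h) = foldr push g (push x (push (linv x) h'))"
      using free_reduce_reduced[OF red] by (simp add: free_reduce_def h')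
    also have "\<dots> = free_reduce (g @ h')"
      using push_linv'[OF red, of x] free_reduce_reduced[OF red] by (simp add: free_reduce_def)
    finally have "free_reduce ((g @ [x]) @ h) = a @ b" using abc by simp
    then show ?thesis using abc h' by (intro exI[of _ a] exI[of _ "c @ [x]"] exI[of _ b]) auto
  next
    case False
    then have "reduced_word ((g @ [x]) @ h)"
      using snoc.prems by (cases h) (auto simp: successively_append_iff)
    then show ?thesis
      using free_reduce_reduced[of "(g @ [x]) @ h"]
      by (intro exI[of _ "g @ [x]"] exI[of _ "[]"] exI[of _ h]) auto
  qed
qed

text \<open>The cancelled part of \<open>h\<close> is too short to reach past \<open>t\<close>. The
  critical case is \<open>a = []\<close>: all of \<open>t\<close> cancels, which uses up
  \<open>h\<close>, so \<open>p\<close> meets nothing.\<close>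

lemma length_mult_append_left:
  assumes red: "reduced_word (p @ t)" "reduced_word h" and len: "length h \<le> length t"
  shows "length (free_reduce ((p @ t) @ h)) = length p + length (free_reduce (t @ h))"
proof -
  have "reduced_word t" using red by (simp add: successively_append_iff)
  then obtain a c b where abc: "t = a @ c" "h = word_inv c @ b" "free_reduce (t @ h) = a @ b"
    using free_reduce_cancellation red by blast
  have "reduced_word (a @ b)" using reduced_free_reduce[of "t @ h"] abc by simp
  moreover have "a = [] \<Longrightarrow> b = []" using len abc by simp
  ultimately have "reduced_word (p @ a @ b)"
    using red(1) abc(1) by (cases "a = []") (auto simp: successively_append_iff)
  moreover have "free_reduce ((p @ t) @ h) = free_reduce (p @ free_reduce (t @ h))" by simp
  ultimately show ?thesis by (simp add: abc(3) free_reduce_reduced)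
qed

section \<open>Conjugation to the cyclic core, and automorphisms on words\<close>

lemma cyc_core_decomposition:
  "\<exists>u. w = u @ cyc_core w @ word_inv u"
proof (induction w rule: cyc_core.induct)
  case (1 w)
  show ?case
  proof (cases "length w \<ge> 2 \<and> last w = linv (hd w)")
    case True
    then obtain u where u: "butlast (tl w) = u @ cyc_core (butlast (tl w)) @ word_inv u"
      using 1 by blast
    have "w = hd w # butlast (tl w) @ [linv (hd w)]"
      using True by (cases w; cases "tl w" rule: rev_cases) auto
    also have "\<dots> = (hd w # u) @ cyc_core (butlast (tl w)) @ word_inv (hd w # u)"
      by (subst u) simp
    also have "cyc_core (butlast (tl w)) = cyc_core w"
      using True by (subst (2) cyc_core.simps) simp
    finally show ?thesis by blast
  next
    case False
    then have "cyc_core w = w" by (subst cyc_core.simps) auto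
    then show ?thesis by (intro exI[of _ "[]"]) simp
  qed
qed

lemma cyc_len_le_length: "cyc_len w \<le> length w"
proof -
  obtain u where "w = u @ cyc_core w @ word_inv u" using cyc_core_decomposition by blast
  from arg_cong[OF this, of length] show ?thesis by (simp add: cyc_len_def)
qed

lemma cyc_core_cyclically_reduced: "cyc_core w \<noteq> [] \<Longrightarrow> last (cyc_core w) \<noteq> linv (hd (cyc_core w))"
proof (induction w rule: cyc_core.induct)
  case (1 w)
  show ?case
  proof (cases "length w \<ge> 2 \<and> last w = linv (hd w)")
    case True
    then have "cyc_core w = cyc_core (butlast (tl w))" by (subst cyc_core.simps) simp
    then show ?thesis using 1 True by simp
  next
    case False
    then have "cyc_core w = w" by (subst cyc_core.simps) auto
    then show ?thesis using False 1(2) by (cases w; cases "tl w") auto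
  qed
qed

locale free_group_auto =
  fixes N :: nat and f :: "letter list \<Rightarrow> letter list"
  assumes f: "f \<in> auto (free_group N)"
begin

sublocale group "free_group N" by (rule group_free_group)

sublocale hom: group_hom "free_group N" "free_group N" f
  using f by unfold_locales (simp add: auto_def)

lemma f_append:
  "u @ v \<in> carrier (free_group N) \<Longrightarrow> f (u @ v) = f u \<otimes>\<^bsub>free_group N\<^esub> f v"
  using carrier_appendD[of u v N] hom.hom_mult[of u v] by (simp add: mult_eq_append)

lemma f_Nil: "f [] = []"
  using hom.hom_one by (simp add: one_free_group)

lemma f_word_inv: "w \<in> carrier (free_group N) \<Longrightarrow> f (word_inv w) = word_inv (f w)"
  using hom.hom_inv[of w] by (simp add: inv_free_group)

lemma reduced_f: "w \<in> carrier (free_group N) \<Longrightarrow> reduced_word (f w)"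
  using hom.hom_closed[of w] by (simp add: carrier_free_group)

end

section \<open>Lipschitz bounds and bounded cancellation\<close>

lemma hom_length_bound:
  assumes "g \<in> hom (free_group N) (free_group N)"
  shows "\<exists>K::nat. \<forall>w\<in>carrier (free_group N). length (g w) \<le> K * length w"
proof -
  interpret group_hom "free_group N" "free_group N" g
    by (intro group_hom.intro group_hom_axioms.intro group_free_group assms)
  \<comment> \<open>The sum over the letters serves as Lipschitz constant; unlike a maximum, it is
    defined for \<open>N = 0\<close> as well.\<close>
  define K where "K = (\<Sum>x\<in>letters N. length (g [x]))"
  have K: "length (g [x]) \<le> K" if "x \<in> letters N" for x
    unfolding K_def using that by (intro member_le_sum) auto
  have "length (g w) \<le> K * length w" if "w \<in> carrier (free_group N)" for w
    using that
  proof (induction w)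
    case Nil
    then show ?case using hom_one by (simp add: one_free_group)
  next
    case (Cons x w)
    then have w: "[x] \<in> carrier (free_group N)" "w \<in> carrier (free_group N)"
      using carrier_appendD[of "[x]" w N] by auto
    have "g (x # w) = g [x] \<otimes>\<^bsub>free_group N\<^esub> g w"
      using mult_eq_append[of "[x]" w N] Cons.prems hom_mult[OF w] by simp
    moreover have "x \<in> letters N" using w by (simp add: carrier_free_group)
    ultimately show ?case
      using length_mult_free_group[of N "g [x]" "g w"] K[of x] Cons.IH[OF w(2)] by simp
  qed
  then show ?thesis by blast
qed

context free_group_auto
begin

text \<open>The second bound is the Lipschitz bound of the inverse automorphism, applied to
  \<open>f w\<close>.\<close>

lemma bi_lipschitz:
  obtains K K' :: nat where "\<And>w. w \<in> carrier (free_group N) \<Longrightarrow> length (f w) \<le> K * length w"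
    "\<And>w. w \<in> carrier (free_group N) \<Longrightarrow> length w \<le> K' * length (f w)"
proof -
  let ?g = "inv_into (carrier (free_group N)) f"
  have iso: "f \<in> iso (free_group N) (free_group N)"
    using f by (auto simp: auto_def iso_def Bij_def)
  then have "?g \<in> hom (free_group N) (free_group N)"
    using iso_set_sym[OF iso] by (simp add: iso_def)
  from hom_length_bound[OF this] obtain K' where
    K': "\<And>w. w \<in> carrier (free_group N) \<Longrightarrow> length (?g w) \<le> K' * length w" by blast
  have "inj_on f (carrier (free_group N))" using iso by (auto simp: iso_def bij_betw_def)
  then have "length w \<le> K' * length (f w)" if "w \<in> carrier (free_group N)" for w
    using K'[of "f w"] that by (simp add: hom.hom_closed)
  with hom_length_bound[OF hom.homh] that show ?thesis by blast
qed

text \<open>A discrete intermediate value argument in the Cayley tree: the images of the prefixes of \<open>u\<close>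
  move from the root to \<open>f u\<close> in jumps of length at most \<open>K\<close>, hence pass within distance \<open>K\<close> of the
  vertex \<open>p\<close> on the geodesic; \<open>u2\<close> is the rest of \<open>u\<close> after this passage.\<close>

lemma suffix_near_image:
  assumes K: "\<And>w. w \<in> carrier (free_group N) \<Longrightarrow> length (f w) \<le> K * length w"
    and "u \<in> carrier (free_group N)" "f u = p @ q"
  shows "\<exists>u1 u2 e. u = u1 @ u2 \<and> e \<in> carrier (free_group N) \<and> length e \<le> K
    \<and> q = e \<otimes>\<^bsub>free_group N\<^esub> f u2"
  using assms(2,3)
proof (induction u arbitrary: q rule: rev_induct)
  case Nil
  then show ?case
    using one_closed by (intro exI[of _ "[]"]) (auto simp: f_Nil one_free_group mult_free_group free_reduce_def)
next
  case (snoc x u)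
  have u: "u \<in> carrier (free_group N)" "[x] \<in> carrier (free_group N)"
    by (rule carrier_appendD[OF snoc.prems(1)])+
  have fux: "f (u @ [x]) = f u \<otimes>\<^bsub>free_group N\<^esub> f [x]" using snoc.prems(1) by (rule f_append)
  have q: "q \<in> carrier (free_group N)" "p \<in> carrier (free_group N)"
    using carrier_appendD[of p q N] hom.hom_closed[OF snoc.prems(1)] snoc.prems(2) by simp_all
  show ?case
  proof (cases "\<exists>q'. f u = p @ q'")
    case True
    then obtain q' where q': "f u = p @ q'" by blast
    then obtain u1 u2 e where *: "u = u1 @ u2" "e \<in> carrier (free_group N)" "length e \<le> K"
      "q' = e \<otimes>\<^bsub>free_group N\<^esub> f u2"
      using snoc.IH u by blast
    have c: "q' \<in> carrier (free_group N)" using carrier_appendD(2)[of p q' N] hom.hom_closed[OF u(1)] q' by simp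
    have u2: "u2 @ [x] \<in> carrier (free_group N)" "u2 \<in> carrier (free_group N)"
      using snoc.prems(1) * carrier_appendD[of u1 "u2 @ [x]" N] carrier_appendD[of u2 "[x]" N] by auto
    have "p \<otimes>\<^bsub>free_group N\<^esub> q = (p \<otimes>\<^bsub>free_group N\<^esub> q') \<otimes>\<^bsub>free_group N\<^esub> f [x]"
      using fux q' snoc.prems(2) hom.hom_closed[OF u(1)] hom.hom_closed[OF snoc.prems(1)]
      by (simp add: mult_eq_append)
    then have "q = q' \<otimes>\<^bsub>free_group N\<^esub> f [x]"
      using q c u(2) by (simp add: m_assoc hom.hom_closed)
    also have "\<dots> = e \<otimes>\<^bsub>free_group N\<^esub> f (u2 @ [x])"
      using * u2 u(2) by (simp add: f_append m_assoc hom.hom_closed)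
    finally show ?thesis using * by (intro exI[of _ u1] exI[of _ "u2 @ [x]"] exI[of _ e]) auto
  next
    case False
    obtain a c b where abc: "f u = a @ c" "f [x] = word_inv c @ b" "free_reduce (f u @ f [x]) = a @ b"
      using free_reduce_cancellation reduced_f u by blast
    then have eq: "a @ b = p @ q" using fux snoc.prems(2) by (simp add: mult_free_group)
    \<comment> \<open>As \<open>p\<close> is a prefix of \<open>a @ b\<close> but not of
      \<open>a\<close>, the word \<open>q\<close> is a suffix of \<open>b\<close>, hence of
      \<open>f [x]\<close>; so \<open>e = q\<close> with empty \<open>u2\<close> works.\<close>
    have "\<not> (\<exists>r. a = p @ r)" using False abc(1) by auto
    then obtain r where "b = r @ q" using eq by (auto simp: append_eq_append_conv2)
    then have "length q \<le> length (f [x])" using abc(2) by simp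
    also have "\<dots> \<le> K" using K[OF u(2)] by simp
    finally show ?thesis using q
      by (intro exI[of _ "u @ [x]"] exI[of _ "[]"] exI[of _ q])
         (auto simp: f_Nil mult_eq_append)
  qed
qed

text \<open>This is Cooper's bounded cancellation lemma. It makes the increments of
  \<open>length (f w)\<close> local and controls the conjugator of \<open>f c\<close> for cyclically
  reduced \<open>c\<close>.\<close>

lemma bounded_cancellation:
  obtains B where "\<And>u v. u @ v \<in> carrier (free_group N) \<Longrightarrow>
    \<exists>p q r. f u = p @ q \<and> f v = word_inv q @ r \<and> f (u @ v) = p @ r \<and> length q \<le> B"
proof -
  obtain K K' where K: "\<And>w. w \<in> carrier (free_group N) \<Longrightarrow> length (f w) \<le> K * length w"
    and K': "\<And>w. w \<in> carrier (free_group N) \<Longrightarrow> length w \<le> K' * length (f w)"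
    by (rule bi_lipschitz) (rule that)
  \<comment> \<open>The image path passes the branch vertex \<open>p\<close> once along \<open>u\<close> and once along \<open>v\<close>; the word read
    between the two passages has a short image, so it is short itself.\<close>
  have "\<exists>p q r. f u = p @ q \<and> f v = word_inv q @ r \<and> f (u @ v) = p @ r \<and> length q \<le> K + K * (K' * (2 * K))"
    if uv: "u @ v \<in> carrier (free_group N)" for u v
  proof -
    have c: "u \<in> carrier (free_group N)" "v \<in> carrier (free_group N)"
      by (rule carrier_appendD[OF uv])+
    obtain p q r where pqr: "f u = p @ q" "f v = word_inv q @ r" "f (u @ v) = p @ r"
      using free_reduce_cancellation[of "f u" "f v"] reduced_f c uv
      by (auto simp: f_append mult_free_group)
    have q: "q \<in> carrier (free_group N)" using carrier_appendD(2)[of p q N] hom.hom_closed[OF c(1)] pqr(1) by simp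
    obtain u1 u2 e where e: "u = u1 @ u2" "e \<in> carrier (free_group N)" "length e \<le> K"
      "q = e \<otimes>\<^bsub>free_group N\<^esub> f u2"
      using suffix_near_image[OF K c(1) pqr(1)] by blast
    \<comment> \<open>The passage along \<open>v\<close> is found from its far end: the image of the
      inverse of \<open>v\<close> also ends in \<open>q\<close>, so the same suffix argument
      applies.\<close>
    have "f (word_inv v) = word_inv r @ q"
      using f_word_inv[OF c(2)] pqr(2) by (simp add: rev_map o_def)
    then obtain v1 v2 e' where e': "word_inv v = v1 @ v2" "e' \<in> carrier (free_group N)" "length e' \<le> K"
      "q = e' \<otimes>\<^bsub>free_group N\<^esub> f v2"
      using suffix_near_image[OF K word_inv_carrier[OF c(2)]] by blast
    have "v = word_inv (word_inv v)" by (simp add: rev_map o_def)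
    then have v: "v = word_inv v2 @ word_inv v1" by (simp add: e'(1))
    have mid: "u2 @ word_inv v2 \<in> carrier (free_group N)"
      using uv carrier_appendD(2)[of u1 "(u2 @ word_inv v2) @ word_inv v1" N]
        carrier_appendD(1)[of "u2 @ word_inv v2" "word_inv v1" N]
      unfolding e(1) v by simp
    have cs: "u2 \<in> carrier (free_group N)" "v2 \<in> carrier (free_group N)"
      using c(1) word_inv_carrier[OF c(2)] carrier_appendD(2)[of u1 u2 N] carrier_appendD(2)[of v1 v2 N]
      by (simp_all add: e(1) e'(1))
    have "f u2 = inv\<^bsub>free_group N\<^esub> e \<otimes>\<^bsub>free_group N\<^esub> q"
      using e cs by (simp add: m_assoc[symmetric] hom.hom_closed)
    moreover have "f v2 = inv\<^bsub>free_group N\<^esub> e' \<otimes>\<^bsub>free_group N\<^esub> q"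
      using e' cs by (simp add: m_assoc[symmetric] hom.hom_closed)
    moreover have "f (u2 @ word_inv v2) = f u2 \<otimes>\<^bsub>free_group N\<^esub> inv\<^bsub>free_group N\<^esub> f v2"
      using mid cs hom.hom_closed by (simp add: f_append f_word_inv inv_free_group)
    \<comment> \<open>The common factor \<open>q\<close> cancels, and only the short words
      \<open>e\<close> and \<open>e'\<close> remain.\<close>
    ultimately have "f (u2 @ word_inv v2) = inv\<^bsub>free_group N\<^esub> e \<otimes>\<^bsub>free_group N\<^esub> (q \<otimes>\<^bsub>free_group N\<^esub> inv\<^bsub>free_group N\<^esub> q) \<otimes>\<^bsub>free_group N\<^esub> e'"
      using e(2) e'(2) q by (simp only: inv_mult_group inv_closed inv_inv m_assoc m_closed)
    also have "\<dots> = inv\<^bsub>free_group N\<^esub> e \<otimes>\<^bsub>free_group N\<^esub> e'"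
      using e(2) e'(2) q by simp
    finally have "length (f (u2 @ word_inv v2)) \<le> 2 * K"
      using length_mult_free_group[of N "inv\<^bsub>free_group N\<^esub> e" e'] e(2,3) e'(3)
      by (simp add: inv_free_group)
    then have "length (u2 @ word_inv v2) \<le> K' * (2 * K)"
      using K'[OF mid] by (meson le_trans mult_le_mono2)
    then have "length (f u2) \<le> K * (K' * (2 * K))"
      using K[OF cs(1)] by (simp only: length_append) (meson add_leD1 le_trans mult_le_mono2)
    then have "length q \<le> K + K * (K' * (2 * K))"
      using length_mult_free_group[of N e "f u2"] e by simp
    then show ?thesis using pqr by blast
  qed
  then show ?thesis using that by blast
qed

text \<open>The image of a long word \<open>v\<close> keeps, next to \<open>x\<close>, a piece longer than \<open>f [x]\<close> that no prefix \<open>u\<close>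
  can cancel.\<close>

lemma length_increment_local:
  obtains L where "\<And>u v x. u @ v @ [x] \<in> carrier (free_group N) \<Longrightarrow> length v \<ge> L \<Longrightarrow>
    int (length (f (u @ v @ [x]))) - int (length (f (u @ v))) = int (length (f (v @ [x]))) - int (length (f v))"
proof -
  obtain K K' where K: "\<And>w. w \<in> carrier (free_group N) \<Longrightarrow> length (f w) \<le> K * length w"
    and K': "\<And>w. w \<in> carrier (free_group N) \<Longrightarrow> length w \<le> K' * length (f w)"
    by (rule bi_lipschitz) (rule that)
  obtain B where B: "\<And>u v. u @ v \<in> carrier (free_group N) \<Longrightarrow>
    \<exists>p q r. f u = p @ q \<and> f v = word_inv q @ r \<and> f (u @ v) = p @ r \<and> length q \<le> B"
    by (rule bounded_cancellation) (rule that)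
  show ?thesis
  proof (rule that)
    fix u v x assume uvx: "u @ v @ [x] \<in> carrier (free_group N)" and L: "length v \<ge> K' * (B + K) + 1"
    have c: "u @ v \<in> carrier (free_group N)" "v @ [x] \<in> carrier (free_group N)"
        "v \<in> carrier (free_group N)" "[x] \<in> carrier (free_group N)"
      using uvx carrier_appendD[of "u @ v" "[x]" N] carrier_appendD[of u "v @ [x]" N]
        carrier_appendD[of v "[x]" N] by auto
    obtain p q t where pqt: "f v = word_inv q @ t" "f (u @ v) = p @ t" "length q \<le> B"
      using B[OF c(1)] by blast
    \<comment> \<open>The image of \<open>v\<close> has more than \<open>B + K\<close> letters;
      after at most \<open>B\<close> of them cancel against \<open>f u\<close>, at least
      \<open>K\<close> remain, as many as \<open>f [x]\<close> can cancel.\<close>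
    have "K' * (B + K) < K' * length (f v)" using K'[OF c(3)] L by linarith
    then have "B + K < length (f v)" by (simp only: mult_less_cancel1)
    then have "length (f [x]) \<le> length t" using pqt K[OF c(4)] by simp
    then have "length (free_reduce ((p' @ t) @ f [x])) = length p' + length (free_reduce (t @ f [x]))"
      if "reduced_word (p' @ t)" for p'
      using that reduced_f[OF c(4)] by (intro length_mult_append_left)
    from this[of p] this[of "word_inv q"]
    show "int (length (f (u @ v @ [x]))) - int (length (f (u @ v))) = int (length (f (v @ [x]))) - int (length (f v))"
      using reduced_f[OF c(1)] reduced_f[OF c(3)] pqt f_append[of "u @ v" "[x]"] f_append[OF c(2)] uvx
      by (simp add: mult_free_group)
  qed
qed

section \<open>Cyclically reduced lengths of images\<close>

lemma cyc_core_carrier: "w \<in> carrier (free_group N) \<Longrightarrow> cyc_core w \<in> carrier (free_group N)"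
  using cyc_core_decomposition[of w] by (metis carrier_appendD)

text \<open>A word is conjugate to its core by some \<open>u\<close>, so the images are conjugate by
  \<open>f u\<close>.\<close>

lemma cyc_len_f_cyc_core:
  assumes "w \<in> carrier (free_group N)"
  shows "cyc_len (f w) = cyc_len (f (cyc_core w))"
proof -
  obtain u where u: "w = u @ cyc_core w @ word_inv u" using cyc_core_decomposition by blast
  define c where "c = cyc_core w"
  have w: "w = u @ c @ word_inv u" using u unfolding c_def .
  have c: "u \<in> carrier (free_group N)" "c \<in> carrier (free_group N)" "c @ word_inv u \<in> carrier (free_group N)"
    using assms carrier_appendD[of u "c @ word_inv u" N] carrier_appendD[of c "word_inv u" N] unfolding w by auto
  have "f w = f u \<otimes>\<^bsub>free_group N\<^esub> f c \<otimes>\<^bsub>free_group N\<^esub> inv\<^bsub>free_group N\<^esub> f u"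
    using assms c hom.hom_closed word_inv_carrier[OF c(1)] word_inv_carrier[OF hom.hom_closed[OF c(1)]]
      f_append[of u "c @ word_inv u"] f_append[of c "word_inv u"]
    unfolding w by (simp add: f_word_inv inv_free_group m_assoc)
  then show ?thesis using cyc_len_conj[OF hom.hom_closed[OF c(1)] hom.hom_closed[OF c(2)]]
    by (simp add: c_def)
qed

text \<open>Passing to the core turns the Lipschitz bound for \<open>length\<close> into one for
  \<open>cyc_len\<close>. It bounds the set whose supremum is
  \<open>extremal_stretch\<close>.\<close>

lemma cyc_len_f_upper:
  obtains K :: nat where "\<And>w. w \<in> carrier (free_group N) \<Longrightarrow> cyc_len (f w) \<le> K * cyc_len w"
proof -
  obtain K K' where K: "\<And>w. w \<in> carrier (free_group N) \<Longrightarrow> length (f w) \<le> K * length w"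
    and "\<And>w. w \<in> carrier (free_group N) \<Longrightarrow> length w \<le> K' * length (f w)"
    by (rule bi_lipschitz) (rule that)
  have "cyc_len (f w) \<le> K * cyc_len w" if "w \<in> carrier (free_group N)" for w
    using cyc_len_f_cyc_core[OF that] cyc_len_le_length[of "f (cyc_core w)"] K[OF cyc_core_carrier[OF that]]
    by (simp add: cyc_len_def)
  then show ?thesis using that by blast
qed

text \<open>Cyclic reduction costs at most \<open>2 * B\<close> on the image of the core, and the
  conjugator of \<open>w\<close> contributes at most \<open>K\<close> times its length on either
  side. This transfers linear growth from \<open>length\<close> to \<open>cyc_len\<close>.\<close>

lemma cyc_len_f_lower:
  obtains B K :: nat where "\<And>w. w \<in> carrier (free_group N) \<Longrightarrow>
    length (f w) \<le> cyc_len (f w) + 2 * B + K * (length w - cyc_len w)"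
proof -
  obtain K K' where K: "\<And>w. w \<in> carrier (free_group N) \<Longrightarrow> length (f w) \<le> K * length w"
    and "\<And>w. w \<in> carrier (free_group N) \<Longrightarrow> length w \<le> K' * length (f w)"
    by (rule bi_lipschitz) (rule that)
  obtain B where B: "\<And>u v. u @ v \<in> carrier (free_group N) \<Longrightarrow>
    \<exists>p q r. f u = p @ q \<and> f v = word_inv q @ r \<and> f (u @ v) = p @ r \<and> length q \<le> B"
    by (rule bounded_cancellation) (rule that)
  show ?thesis
  proof (rule that)
    fix w assume w: "w \<in> carrier (free_group N)"
    define c where "c = cyc_core w"
    have c: "c \<in> carrier (free_group N)" using cyc_core_carrier[OF w] by (simp add: c_def)
    \<comment> \<open>As \<open>c @ c\<close> is reduced, bounded cancellation for \<open>f (c @ c)\<close> bounds the conjugator of \<open>f c\<close>.\<close>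
    have core: "length (f c) \<le> cyc_len (f c) + 2 * B"
    proof (cases "c = []")
      case False
      then have "last c \<noteq> linv (hd c)" using cyc_core_cyclically_reduced by (simp add: c_def)
      then have "hd c \<noteq> linv (last c)" by (metis linv_linv)
      then have cc: "c @ c \<in> carrier (free_group N)"
        using c by (auto simp: carrier_free_group successively_append_iff)
      obtain p q r where pqr: "f c = p @ q" "f c = word_inv q @ r" "f (c @ c) = p @ r" "length q \<le> B"
        using B[OF cc] by blast
      have "length p + length q = length (f c)" "length q + length r = length (f c)"
        using arg_cong[OF pqr(1), of length] arg_cong[OF pqr(2), of length] by simp_all
      then have 1: "2 * length (f c) \<le> length (f (c @ c)) + 2 * B" using pqr(3,4) by simp
      obtain s where s: "f c = s @ cyc_core (f c) @ word_inv s" using cyc_core_decomposition by blast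
      define d where "d = cyc_core (f c)"
      have s: "f c = s @ d @ word_inv s" using s unfolding d_def .
      have "f (c @ c) = free_reduce ((s @ d) @ (word_inv s @ s) @ (d @ word_inv s))"
        using f_append[OF cc] by (simp add: s mult_free_group)
      also have "\<dots> = free_reduce ((s @ d) @ free_reduce (free_reduce (word_inv s @ s) @ (d @ word_inv s)))"
        by (simp only: free_reduce_append_free_reduce)
      also have "\<dots> = free_reduce (s @ d @ d @ word_inv s)"
        unfolding free_reduce_inverse append_Nil free_reduce_append_free_reduce by simp
      finally have "length (f (c @ c)) \<le> 2 * length s + 2 * length d"
        using length_free_reduce[of "s @ d @ d @ word_inv s"] by simp
      moreover have "length (f c) = 2 * length s + length d" "cyc_len (f c) = length d"
        using arg_cong[OF s, of length] by (simp_all add: d_def cyc_len_def)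
      \<comment> \<open>With S and D the lengths of \<open>s\<close> and \<open>d\<close>, the
        estimates say 4S + 2D \<le> 2S + 2D + 2B, so S \<le> B.\<close>
      ultimately show ?thesis using 1 by linarith
    qed (simp add: f_Nil)
    obtain u where u: "w = u @ cyc_core w @ word_inv u" using cyc_core_decomposition by blast
    then have u: "w = u @ c @ word_inv u" unfolding c_def .
    have cs: "u \<in> carrier (free_group N)" "c @ word_inv u \<in> carrier (free_group N)"
      using w carrier_appendD[of u "c @ word_inv u" N] u by auto
    have "f w = f u \<otimes>\<^bsub>free_group N\<^esub> (f c \<otimes>\<^bsub>free_group N\<^esub> word_inv (f u))"
      using f_append[of u "c @ word_inv u"] f_append[OF cs(2)] f_word_inv[OF cs(1)] w unfolding u by simp
    then have "length (f w) \<le> length (f u) + (length (f c) + length (f u))"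
      using length_mult_free_group[of N "f u" "f c \<otimes>\<^bsub>free_group N\<^esub> word_inv (f u)"]
        length_mult_free_group[of N "f c" "word_inv (f u)"] by simp
    also have "\<dots> \<le> length (f c) + K * (2 * length u)" using K[OF cs(1)] by simp
    also have "2 * length u = length w - cyc_len w"
      using arg_cong[OF u, of length] by (simp add: c_def cyc_len_def)
    finally show "length (f w) \<le> cyc_len (f w) + 2 * B + K * (length w - cyc_len w)"
      using core cyc_len_f_cyc_core[OF w] by (simp add: c_def)
  qed
qed

end

section \<open>Averages over reduced words and the strong law of large numbers\<close>

definition red_words :: "nat \<Rightarrow> nat \<Rightarrow> letter list set" where
  "red_words N n = {w \<in> lists (letters N). reduced_word w \<and> length w = n}"

definition next_letters :: "nat \<Rightarrow> letter list \<Rightarrow> letter set" where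
  "next_letters N w = letters N - (if w = [] then {} else {linv (last w)})"

text \<open>For \<open>N > 0\<close> this is the expectation of \<open>F\<close> on the prefix of
  length \<open>n\<close> of the walk, so moments can be estimated by finite sums.\<close>

definition word_avg :: "nat \<Rightarrow> nat \<Rightarrow> (letter list \<Rightarrow> real) \<Rightarrow> real" where
  "word_avg N n F = (\<Sum>w\<in>red_words N n. F w) / real (card (red_words N n))"

lemma card_letters: "card (letters N) = 2 * N"
  by (simp add: letters_def card_cartesian_product)

lemma finite_next_letters [simp]: "finite (next_letters N w)"
  by (simp add: next_letters_def)

lemma card_next_letters:
  assumes "w \<in> red_words N n"
  shows "card (next_letters N w) = (if n = 0 then 2 * N else 2 * N - 1)"
proof (cases "w = []")
  case True
  then show ?thesis using assms by (auto simp: next_letters_def card_letters red_words_def)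
next
  case False
  then have "last w \<in> letters N" using assms by (auto simp: red_words_def)
  then show ?thesis using assms False
    by (auto simp: next_letters_def card_letters red_words_def)
qed

lemma finite_red_words [simp]: "finite (red_words N n)"
  using finite_lists_length_eq[OF finite_letters, of N n]
  by (rule rev_finite_subset) (auto simp: red_words_def)

lemma red_words_0: "red_words N 0 = {[]}"
  by (auto simp: red_words_def)

lemma red_words_Suc:
  "red_words N (Suc n) = (\<lambda>(w, z). w @ [z]) ` (SIGMA w:red_words N n. next_letters N w)"
  (is "?A = ?B")
proof (intro equalityI subsetI)
  fix v assume v: "v \<in> ?A"
  then obtain w z where wz: "v = w @ [z]"
    by (cases v rule: rev_cases) (auto simp: red_words_def)
  then show "v \<in> ?B" using v
    by (auto simp: red_words_def next_letters_def successively_append_iff split: if_splits intro!: image_eqI[of _ _ "(w, z)"])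
next
  fix v assume "v \<in> ?B"
  then show "v \<in> ?A"
    by (auto simp: red_words_def next_letters_def successively_append_iff split: if_splits)
qed

lemma sum_red_words_Suc:
  fixes F :: "letter list \<Rightarrow> 'a::comm_monoid_add"
  shows "(\<Sum>w\<in>red_words N (Suc n). F w) = (\<Sum>w\<in>red_words N n. \<Sum>z\<in>next_letters N w. F (w @ [z]))"
proof -
  have "(\<Sum>w\<in>red_words N (Suc n). F w)
      = (\<Sum>p\<in>(SIGMA w:red_words N n. next_letters N w). F (case p of (w, z) \<Rightarrow> w @ [z]))"
    unfolding red_words_Suc by (subst sum.reindex) (auto simp: inj_on_def o_def)
  also have "\<dots> = (\<Sum>w\<in>red_words N n. \<Sum>z\<in>next_letters N w. F (w @ [z]))"
    by (subst sum.Sigma) (auto intro!: sum.cong)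
  finally show ?thesis .
qed

lemma card_red_words_Suc:
  "card (red_words N (Suc n)) = card (red_words N n) * (if n = 0 then 2 * N else 2 * N - 1)"
  using sum_red_words_Suc[of "\<lambda>_. 1::nat" N n] card_next_letters[of _ N n] by simp

lemma card_red_words_pos: "N > 0 \<Longrightarrow> card (red_words N n) > 0"
  by (induction n) (auto simp: card_red_words_Suc red_words_0)

lemma card_red_words_add:
  "n > 0 \<Longrightarrow> card (red_words N (n + m)) = card (red_words N n) * (2 * N - 1) ^ m"
  by (induction m) (auto simp: card_red_words_Suc)

lemma word_avg_mono:
  "(\<And>w. w \<in> red_words N n \<Longrightarrow> F w \<le> G w) \<Longrightarrow> word_avg N n F \<le> word_avg N n G"
  unfolding word_avg_def by (intro divide_right_mono sum_mono) auto

lemma word_avg_nonneg: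
  "(\<And>w. w \<in> red_words N n \<Longrightarrow> 0 \<le> F w) \<Longrightarrow> 0 \<le> word_avg N n F"
  unfolding word_avg_def by (intro divide_nonneg_nonneg sum_nonneg) auto

lemma word_avg_affine:
  assumes "N > 0"
  shows "word_avg N n (\<lambda>w. a * F w + b) = a * word_avg N n F + b"
  using card_red_words_pos[OF assms, of n] finite_red_words[of N n]
  by (simp add: word_avg_def sum.distrib card_gt_0_iff add_divide_distrib flip: sum_distrib_left)

lemma word_avg_Suc:
  "word_avg N (Suc n) F
   = word_avg N n (\<lambda>w. (\<Sum>z\<in>next_letters N w. F (w @ [z])) / real (card (next_letters N w)))"
  using card_next_letters[of _ N n]
  by (simp add: word_avg_def sum_red_words_Suc card_red_words_Suc sum_divide_distrib field_simps)

lemma word_avg_Suc_le: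
  assumes "N > 0"
    and "\<And>w. w \<in> red_words N n \<Longrightarrow>
      (\<Sum>z\<in>next_letters N w. F (w @ [z])) \<le> real (card (next_letters N w)) * H w"
  shows "word_avg N (Suc n) F \<le> word_avg N n H"
proof -
  have "card (next_letters N w) > 0" if "w \<in> red_words N n" for w
    using card_next_letters[OF that] assms(1) by auto
  then show ?thesis
    unfolding word_avg_Suc using assms(2)
    by (intro word_avg_mono) (auto simp: divide_le_eq mult.commute)
qed

section \<open>The law of the prefixes of the walk\<close>

lemma measurable_prefix:
  fixes M :: "(nat \<Rightarrow> letter) measure"
  assumes "sets M = sets (PiM I (\<lambda>_. count_space UNIV))" "{..<n} \<subseteq> I"
  shows "(\<lambda>y. map y [0..<n]) \<in> measurable M (count_space UNIV)"
\<comment> \<open>There are only countably many words, so preimages of single words suffice.\<close>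
proof (rule measurable_count_space_eq2_countable[THEN iffD2], intro conjI ballI)
  fix w :: "letter list"
  show "(\<lambda>y. map y [0..<n]) -` {w} \<inter> space M \<in> sets M"
  proof (cases "length w = n")
    case True
    have comp: "(\<lambda>y. y i) \<in> measurable M (count_space UNIV)" if "i < n" for i
      unfolding measurable_cong_sets[OF assms(1) refl]
      by (rule measurable_component_singleton) (use assms(2) that in blast)
    have "map y [0..<n] = w \<longleftrightarrow> (\<forall>i\<in>{..<n}. y i = w ! i)" for y :: "nat \<Rightarrow> letter"
      using True list_eq_iff_nth_eq[of "map y [0..<n]" w] by auto
    then have "(\<lambda>y. map y [0..<n]) -` {w} \<inter> space M = {y\<in>space M. \<forall>i\<in>{..<n}. y i = w ! i}"
      by blast
    also have "\<dots> \<in> sets M"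
    proof (rule sets.sets_Collect_finite_All)
      fix i assume "i \<in> {..<n}"
      then have "(\<lambda>y. y i) -` {w ! i} \<inter> space M \<in> sets M"
        using comp by (intro measurable_sets) auto
      then show "{y \<in> space M. y i = w ! i} \<in> sets M"
        by (simp add: vimage_def Int_def conj_commute)
    qed auto
    finally show ?thesis .
  next
    case False
    then have "(\<lambda>y. map y [0..<n]) -` {w} \<inter> space M = {}" by auto
    then show ?thesis by simp
  qed
qed auto

lemma sets_nbw: "sets (nbw N) = sets (PiM UNIV (\<lambda>_. count_space UNIV))"
proof -
  interpret Ionescu_Tulcea "nbw_step N" "\<lambda>_. count_space UNIV" by (rule Ionescu_Tulcea_nbw)
  show ?thesis unfolding nbw_def by (rule PF.sets_lim)
qed

lemma nbw_step_eq:
  "nbw_step N n x = measure_pmf (pmf_of_set (next_letters N (map x [0..<n])))"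
  by (cases n) (auto simp: nbw_step_def next_letters_def)

text \<open>Each step is uniform on \<open>next_letters\<close>, whose size depends only on the
  length of the word, so the prefix is uniform on reduced words. The induction runs over the finite
  stages of the Ionescu-Tulcea construction; the limit measure is reached by restricting to the
  first \<open>n\<close> coordinates.\<close>

lemma nn_integral_prefix:
  fixes F :: "letter list \<Rightarrow> real"
  assumes N: "N > 0" and F: "\<And>w. F w \<ge> 0"
  shows "(\<integral>\<^sup>+y. ennreal (F (map y [0..<n])) \<partial>nbw N) = ennreal (word_avg N n F)"
proof -
  interpret Ionescu_Tulcea "nbw_step N" "\<lambda>_. count_space UNIV" by (rule Ionescu_Tulcea_nbw)
  let ?P = "\<lambda>I. PiM I (\<lambda>_. count_space UNIV :: letter measure)"
  let ?C = "\<lambda>n. C 0 n (\<lambda>_. undefined)"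
  let ?ne = "\<lambda>w. next_letters N w \<noteq> {}"
  \<comment> \<open>\<open>pmf_of_set\<close> has its intended meaning only on nonempty finite
    sets.\<close>
  have ne: "?ne w" for w
  proof
    assume "next_letters N w = {}"
    then have "letters N \<subseteq> (if w = [] then {} else {linv (last w)})"
      by (auto simp: next_letters_def)
    then have "card (letters N) \<le> 1"
      using card_mono[of "{linv (last w)}" "letters N"] by (auto split: if_splits)
    then show False using N by (simp add: card_letters)
  qed
  have measF: "(\<lambda>x. G (map x [0..<n])) \<in> borel_measurable (?P {0..<n})" for G :: "letter list \<Rightarrow> ennreal" and n
    by (rule measurable_compose[OF measurable_prefix]) (auto simp: refl)
  have step: "(\<integral>\<^sup>+x. ennreal (F (map x [0..<n])) \<partial>?C n) = ennreal (word_avg N n F)"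
    if "\<And>w. F w \<ge> 0" for F n
    using that
  proof (induction n arbitrary: F)
    case 0
    then show ?case
      by (simp add: nn_integral_return space_PiM word_avg_def red_words_0 del: nn_integral_const)
  next
    case (Suc n)
    have "(\<integral>\<^sup>+x. ennreal (F (map x [0..<Suc n])) \<partial>?C (Suc n))
        = (\<integral>\<^sup>+x. (\<integral>\<^sup>+x'. ennreal (F (map x' [0..<Suc n])) \<partial>eP n x) \<partial>?C n)"
      using measF[of "\<lambda>w. ennreal (F w)" "Suc n"] measurable_eP[of n]
      by (simp del: upt_Suc)
         (rule nn_integral_bind[where B="?P {0..<Suc n}"],
          auto simp: measurable_cong_sets[OF sets_C refl] simp del: upt_Suc)
    also have "\<dots> = (\<integral>\<^sup>+x. ennreal ((\<Sum>z\<in>next_letters N (map x [0..<n]). F (map x [0..<n] @ [z]))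
          / real (card (next_letters N (map x [0..<n])))) \<partial>?C n)"
    proof (rule nn_integral_cong)
      fix x assume "x \<in> space (?C n)"
      then have x: "x \<in> space (?P {0..<n})" by (simp add: space_C)
      let ?S = "next_letters N (map x [0..<n])"
      have "(\<integral>\<^sup>+x'. ennreal (F (map x' [0..<Suc n])) \<partial>eP n x)
          = (\<integral>\<^sup>+z. ennreal (F (map (x(n := z)) [0..<Suc n])) \<partial>nbw_step N n x)"
        by (rule nn_integral_eP[OF x measF])
      also have "\<dots> = (\<integral>\<^sup>+z. ennreal (F (map x [0..<n] @ [z])) \<partial>nbw_step N n x)"
        by (intro nn_integral_cong arg_cong[where f="\<lambda>w. ennreal (F w)"]) simp
      also have "\<dots> = (\<Sum>z\<in>?S. ennreal (F (map x [0..<n] @ [z]))) / ennreal (real (card ?S))"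
        unfolding nbw_step_eq
        by (subst nn_integral_pmf_of_set) (auto simp: ne ennreal_of_nat_eq_real_of_nat)
      also have "\<dots> = ennreal ((\<Sum>z\<in>?S. F (map x [0..<n] @ [z])) / real (card ?S))"
        using Suc.prems ne[of "map x [0..<n]"]
        by (subst sum_ennreal) (auto intro!: divide_ennreal sum_nonneg simp: card_gt_0_iff)
      finally show "(\<integral>\<^sup>+x'. ennreal (F (map x' [0..<Suc n])) \<partial>eP n x)
        = ennreal ((\<Sum>z\<in>?S. F (map x [0..<n] @ [z])) / real (card ?S))" .
    qed
    also have "\<dots> = ennreal (word_avg N n (\<lambda>w. (\<Sum>z\<in>next_letters N w. F (w @ [z])) / real (card (next_letters N w))))"
      using Suc.prems by (intro Suc.IH) (auto intro!: divide_nonneg_nonneg sum_nonneg)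
    finally show ?case by (simp only: word_avg_Suc)
  qed
  \<comment> \<open>\<open>CI\<close> is built from the stage \<open>up_to {0..<n}\<close>, which
    has to be identified with stage \<open>n\<close>.\<close>
  have up: "up_to {0..<n} = n"
    using up_to_less[of "{0..<n}" "up_to {0..<n}"] up_to_iff[of "{0..<n}" n] by force
  have map_restrict: "map (restrict y {0..<n}) [0..<n] = map y [0..<n]" for y :: "nat \<Rightarrow> letter"
    by simp
  have mr: "(\<lambda>x. restrict x {0..<n}) \<in> measurable (nbw N) (?P {0..<n})"
    by (auto simp: measurable_cong_sets[OF sets_nbw refl] intro!: measurable_restrict)
  have mr': "(\<lambda>x. restrict x {0..<n}) \<in> measurable (?C n) (?P {0..<n})"
    by (auto simp: measurable_cong_sets[OF sets_C refl] space_PiM intro!: measurable_restrict)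
  have "(\<integral>\<^sup>+y. ennreal (F (map y [0..<n])) \<partial>nbw N)
      = (\<integral>\<^sup>+y. ennreal (F (map y [0..<n])) \<partial>distr (nbw N) (?P {0..<n}) (\<lambda>x. restrict x {0..<n}))"
    using measF[of "\<lambda>w. ennreal (F w)" n]
    by (subst nn_integral_distr[OF mr]) (simp_all only: map_restrict measurable_distr_eq1)
  also have "\<dots> = (\<integral>\<^sup>+y. ennreal (F (map y [0..<n])) \<partial>CI {0..<n})"
    using distr_lim[of "{0..<n}"] by (simp add: nbw_def)
  also have "\<dots> = (\<integral>\<^sup>+y. ennreal (F (map y [0..<n])) \<partial>?C n)"
    unfolding CI_def up using measF[of "\<lambda>w. ennreal (F w)" n]
    by (subst nn_integral_distr[OF mr']) (simp_all only: map_restrict measurable_distr_eq1)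
  also have "\<dots> = ennreal (word_avg N n F)" by (rule step[OF F])
  finally show ?thesis .
qed

lemma borel_measurable_prefix:
  "(\<lambda>y. G (map y [0..<n])) \<in> borel_measurable (nbw N)"
  by (rule measurable_compose[OF measurable_prefix[OF sets_nbw]]) auto

text \<open>A Borel-Cantelli argument: the series has finite expectation, so almost surely it
  converges and its terms tend to 0.\<close>

lemma AE_prefix_tendsto_0:
  assumes N: "N > 0" and nonneg: "\<And>n w. F n w \<ge> 0"
    and avg: "\<And>n. word_avg N n (F n) \<le> c n" and "summable c"
  shows "AE y in nbw N. (\<lambda>n. F n (map y [0..<n])) \<longlonglongrightarrow> 0"
proof -
  have c: "c n \<ge> 0" for n
    using avg[of n] word_avg_nonneg[of N n "F n"] nonneg by (meson order_trans)
  have meas: "(\<lambda>y. ennreal (F n (map y [0..<n]))) \<in> borel_measurable (nbw N)" for n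
    by (rule borel_measurable_prefix)
  have "(\<integral>\<^sup>+y. (\<Sum>n. ennreal (F n (map y [0..<n]))) \<partial>nbw N)
      = (\<Sum>n. \<integral>\<^sup>+y. ennreal (F n (map y [0..<n])) \<partial>nbw N)"
    by (rule nn_integral_suminf[OF meas])
  also have "\<dots> \<le> (\<Sum>n. ennreal (c n))"
    using nn_integral_prefix[OF N, of "F n" n for n] nonneg avg c
    by (intro suminf_le) (auto simp: ennreal_leI)
  also have "\<dots> < \<infinity>"
    using suminf_ennreal2[OF c \<open>summable c\<close>] by simp
  finally have "AE y in nbw N. (\<Sum>n. ennreal (F n (map y [0..<n]))) \<noteq> \<infinity>"
    using meas by (intro nn_integral_PInf_AE) auto
  then show ?thesis
  proof (rule AE_mp, intro AE_I2 impI)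
    fix y assume "(\<Sum>n. ennreal (F n (map y [0..<n]))) \<noteq> \<infinity>"
    then have "summable (\<lambda>n. F n (map y [0..<n]))"
      using nonneg by (intro summable_suminf_not_top) auto
    then show "(\<lambda>n. F n (map y [0..<n])) \<longlonglongrightarrow> 0" by (rule summable_LIMSEQ_zero)
  qed
qed

lemma AE_prefix_red_words:
  assumes N: "N > 0"
  shows "AE y in nbw N. \<forall>n. map y [0..<n] \<in> red_words N n"
proof (rule AE_all_countable[THEN iffD2], intro allI)
  fix n
  let ?F = "\<lambda>w. of_bool (w \<notin> red_words N n) :: real"
  have "(\<integral>\<^sup>+y. ennreal (?F (map y [0..<n])) \<partial>nbw N) = 0"
    using nn_integral_prefix[OF N, of ?F n] by (simp add: word_avg_def)
  then have "AE y in nbw N. ennreal (?F (map y [0..<n])) = 0"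
    using borel_measurable_prefix[of "\<lambda>w. ennreal (?F w)" n N] by (simp add: nn_integral_0_iff_AE)
  then show "AE y in nbw N. map y [0..<n] \<in> red_words N n"
    by (rule AE_mp) auto
qed

section \<open>Martingale differences and strong laws\<close>

lemma martingale_moments:
  fixes d :: "letter list \<Rightarrow> real"
  assumes N: "N > 0" and bound: "\<And>w. \<bar>d w\<bar> \<le> C"
    and centered: "\<And>n w. w \<in> red_words N n \<Longrightarrow> (\<Sum>z\<in>next_letters N w. d (w @ [z])) = 0"
  defines "S \<equiv> \<lambda>w. \<Sum>j<length w. d (take (Suc j) w)"
  shows "word_avg N n (\<lambda>w. (S w)\<^sup>2) \<le> C\<^sup>2 * real n"
    and "word_avg N n (\<lambda>w. (S w) ^ 4) \<le> 4 * C ^ 4 * (real n)\<^sup>2"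
proof -
  have S_snoc: "S (w @ [z]) = S w + d (w @ [z])" for w z
    by (simp add: S_def)
  have d2: "(d w)\<^sup>2 \<le> C\<^sup>2" for w
    using bound[of w] by (metis abs_ge_zero power2_abs power_mono)
  have step2: "word_avg N (Suc n) (\<lambda>w. (S w)\<^sup>2) \<le> word_avg N n (\<lambda>w. 1 * (S w)\<^sup>2 + C\<^sup>2)" for n
  proof (rule word_avg_Suc_le[OF N])
    fix w assume w: "w \<in> red_words N n"
    have "(\<Sum>z\<in>next_letters N w. (S (w @ [z]))\<^sup>2)
        \<le> (\<Sum>z\<in>next_letters N w. ((S w)\<^sup>2 + C\<^sup>2) + 2 * S w * d (w @ [z]))"
      using d2 by (intro sum_mono) (simp add: S_snoc power2_sum)
    \<comment> \<open>The cross term vanishes by centering, because \<open>S w\<close> is fixed by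
      the prefix.\<close>
    also have "\<dots> = real (card (next_letters N w)) * (1 * (S w)\<^sup>2 + C\<^sup>2)"
      using centered[OF w] by (simp add: sum.distrib flip: sum_distrib_left)
    finally show "(\<Sum>z\<in>next_letters N w. (S (w @ [z]))\<^sup>2) \<le> \<dots>" .
  qed
  have base: "word_avg N 0 (\<lambda>w. (S w) ^ k) = 0" if "k > 0" for k
    using that by (simp add: word_avg_def red_words_0 S_def)
  show second: "word_avg N n (\<lambda>w. (S w)\<^sup>2) \<le> C\<^sup>2 * real n" for n
  proof (induction n)
    case (Suc n)
    then show ?case using step2[of n] unfolding word_avg_affine[OF N] by (simp add: algebra_simps)
  qed (use base in simp)
  have step4: "word_avg N (Suc n) (\<lambda>w. (S w) ^ 4)
      \<le> word_avg N n (\<lambda>w. 1 * ((S w) ^ 4 + 8 * C\<^sup>2 * (S w)\<^sup>2) + 3 * C ^ 4)" for n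
  proof (rule word_avg_Suc_le[OF N])
    fix w assume w: "w \<in> red_words N n"
    have pt: "(S w + t) ^ 4 \<le> (S w) ^ 4 + 8 * C\<^sup>2 * (S w)\<^sup>2 + 3 * C ^ 4 + 4 * (S w) ^ 3 * t"
      if "t\<^sup>2 \<le> C\<^sup>2" for t
    proof -
      have 1: "(S w)\<^sup>2 * t\<^sup>2 \<le> C\<^sup>2 * (S w)\<^sup>2"
        using mult_left_mono[OF that, of "(S w)\<^sup>2"] by (simp add: mult.commute)
      have 2: "t ^ 4 \<le> C ^ 4"
        using power_mono[OF that, of 2] by (simp flip: power_mult)
      \<comment> \<open>The square of \<open>S w * t - t^2\<close> is nonnegative, which trades the
        odd term for even ones; this gives the coefficients 8 = 6 + 2 and 3 = 1 + 2.\<close>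
      have 3: "4 * S w * t ^ 3 \<le> 2 * ((S w)\<^sup>2 * t\<^sup>2) + 2 * t ^ 4"
        using zero_le_power2[of "S w * t - t\<^sup>2"]
        by (simp add: power2_eq_square power3_eq_cube power4_eq_xxxx algebra_simps)
      have "(S w + t) ^ 4 = (S w) ^ 4 + 4 * (S w) ^ 3 * t + 6 * ((S w)\<^sup>2 * t\<^sup>2) + 4 * S w * t ^ 3 + t ^ 4"
        by (simp add: power2_eq_square power3_eq_cube power4_eq_xxxx algebra_simps)
      then show ?thesis using 1 2 3 by linarith
    qed
    have "(\<Sum>z\<in>next_letters N w. (S (w @ [z])) ^ 4)
        \<le> (\<Sum>z\<in>next_letters N w. ((S w) ^ 4 + 8 * C\<^sup>2 * (S w)\<^sup>2 + 3 * C ^ 4) + 4 * (S w) ^ 3 * d (w @ [z]))"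
      using pt[OF d2] by (intro sum_mono) (simp add: S_snoc)
    also have "\<dots> = real (card (next_letters N w)) * (1 * ((S w) ^ 4 + 8 * C\<^sup>2 * (S w)\<^sup>2) + 3 * C ^ 4)"
      using centered[OF w] by (simp add: sum.distrib algebra_simps flip: sum_distrib_left)
    finally show "(\<Sum>z\<in>next_letters N w. (S (w @ [z])) ^ 4) \<le> \<dots>" .
  qed
  have avg_add: "word_avg N n (\<lambda>w. (S w) ^ 4 + 8 * C\<^sup>2 * (S w)\<^sup>2)
      = word_avg N n (\<lambda>w. (S w) ^ 4) + 8 * C\<^sup>2 * word_avg N n (\<lambda>w. (S w)\<^sup>2)" for n
    by (simp add: word_avg_def sum.distrib add_divide_distrib flip: sum_distrib_left)
  show "word_avg N n (\<lambda>w. (S w) ^ 4) \<le> 4 * C ^ 4 * (real n)\<^sup>2"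
  proof (induction n)
    case (Suc n)
    have "word_avg N (Suc n) (\<lambda>w. (S w) ^ 4)
        \<le> word_avg N n (\<lambda>w. (S w) ^ 4) + 8 * C\<^sup>2 * word_avg N n (\<lambda>w. (S w)\<^sup>2) + 3 * C ^ 4"
      using step4[of n] unfolding word_avg_affine[OF N] avg_add by simp
    also have "8 * C\<^sup>2 * word_avg N n (\<lambda>w. (S w)\<^sup>2) \<le> 8 * C\<^sup>2 * (C\<^sup>2 * real n)"
      using second[of n] by (intro mult_left_mono) auto
    also have "word_avg N n (\<lambda>w. (S w) ^ 4) + 8 * C\<^sup>2 * (C\<^sup>2 * real n) + 3 * C ^ 4
        \<le> 4 * C ^ 4 * (real n)\<^sup>2 + 8 * C\<^sup>2 * (C\<^sup>2 * real n) + 3 * C ^ 4"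
      using Suc by simp
    \<comment> \<open>Up to the factor \<open>C ^ 4\<close> this is 4n^2 + 8n + 3 \<le> 4(n +
      1)^2.\<close>
    also have "\<dots> \<le> 4 * C ^ 4 * (real (Suc n))\<^sup>2"
      using zero_le_power_eq[of C 4] by (simp add: power2_eq_square power4_eq_xxxx algebra_simps)
    finally show ?case by simp
  qed (use base in simp)
qed

text \<open>The fourth moment of \<open>S w / n\<close> is of order 1/n^2 and hence summable; the
  second moment would give only 1/n.\<close>

lemma martingale_slln:
  fixes d :: "letter list \<Rightarrow> real"
  assumes N: "N > 0" and bound: "\<And>w. \<bar>d w\<bar> \<le> C"
    and centered: "\<And>n w. w \<in> red_words N n \<Longrightarrow> (\<Sum>z\<in>next_letters N w. d (w @ [z])) = 0"
  shows "AE y in nbw N. (\<lambda>n. (\<Sum>j<n. d (map y [0..<Suc j])) / real n) \<longlonglongrightarrow> 0"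
proof -
  define S where "S w = (\<Sum>j<length w. d (take (Suc j) w))" for w
  have "AE y in nbw N. (\<lambda>n. (S (map y [0..<n]) / real n) ^ 4) \<longlonglongrightarrow> 0"
  proof (rule AE_prefix_tendsto_0[OF N, where F="\<lambda>n w. (S w / real n) ^ 4"])
    show "word_avg N n (\<lambda>w. (S w / real n) ^ 4) \<le> 4 * C ^ 4 * inverse ((real n)\<^sup>2)" for n
    proof (cases "n = 0")
      case False
      have "word_avg N n (\<lambda>w. (S w / real n) ^ 4) = word_avg N n (\<lambda>w. (S w) ^ 4) / real n ^ 4"
        by (simp add: word_avg_def power_divide flip: sum_divide_distrib)
      also have "\<dots> \<le> 4 * C ^ 4 * (real n)\<^sup>2 / real n ^ 4"
        using martingale_moments(2)[of N d C n, OF N bound centered]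
        by (intro divide_right_mono) (auto simp: S_def)
      also have "\<dots> = 4 * C ^ 4 * inverse ((real n)\<^sup>2)"
        using False by (simp add: field_simps power2_eq_square power4_eq_xxxx)
      finally show ?thesis .
    qed (simp add: word_avg_def)
    show "summable (\<lambda>n. 4 * C ^ 4 * inverse ((real n)\<^sup>2))"
      by (intro summable_mult inverse_power_summable) simp
  qed simp
  then show ?thesis
  proof (rule AE_mp, intro AE_I2 impI)
    fix y assume *: "(\<lambda>n. (S (map y [0..<n]) / real n) ^ 4) \<longlonglongrightarrow> 0"
    have "S (map y [0..<n]) = (\<Sum>j<n. d (map y [0..<Suc j]))" for n
      unfolding S_def by (intro sum.cong) (auto simp: take_map simp del: upt_Suc)
    with * have "(\<lambda>n. ((\<Sum>j<n. d (map y [0..<Suc j])) / real n) ^ 4) \<longlonglongrightarrow> 0" by simp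
    then show "(\<lambda>n. (\<Sum>j<n. d (map y [0..<Suc j])) / real n) \<longlonglongrightarrow> 0"
      by (subst (asm) power_tendsto_0_iff) simp_all
  qed
qed

text \<open>The conditional expectation of \<open>G\<close> at the next prefix, given that the
  present prefix is \<open>w\<close>.\<close>

definition cond_avg :: "nat \<Rightarrow> (letter list \<Rightarrow> real) \<Rightarrow> letter list \<Rightarrow> real" where
  "cond_avg N G w = (\<Sum>z\<in>next_letters N w. G (w @ [z])) / real (card (next_letters N w))"

lemma abs_cond_avg_le:
  assumes "\<And>w. \<bar>G w\<bar> \<le> C"
  shows "\<bar>cond_avg N G w\<bar> \<le> C"
proof -
  have "\<bar>\<Sum>z\<in>next_letters N w. G (w @ [z])\<bar> \<le> (\<Sum>z\<in>next_letters N w. C)"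
    by (rule order_trans[OF sum_abs sum_mono]) (rule assms)
  moreover have "0 \<le> C" using assms[of "[]"] by linarith
  ultimately show ?thesis
    by (cases "card (next_letters N w) = 0") (simp_all add: cond_avg_def divide_le_eq mult.commute)
qed

text \<open>Subtracting the conditional expectation given the word without its last letter turns
  \<open>G\<close> into a bounded martingale difference.\<close>

lemma cond_avg_slln:
  assumes N: "N > 0" and bound: "\<And>w. \<bar>G w\<bar> \<le> C"
  shows "AE y in nbw N. (\<lambda>n. ((\<Sum>j<n. G (map y [0..<Suc j])) - (\<Sum>j<n. cond_avg N G (map y [0..<j]))) / real n) \<longlonglongrightarrow> 0"
proof -
  let ?d = "\<lambda>w. G w - cond_avg N G (butlast w)"
  have "AE y in nbw N. (\<lambda>n. (\<Sum>j<n. ?d (map y [0..<Suc j])) / real n) \<longlonglongrightarrow> 0"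
  proof (rule martingale_slln[OF N])
    fix w show "\<bar>?d w\<bar> \<le> 2 * C"
      using bound[of w] abs_cond_avg_le[of G C N "butlast w", OF bound] by linarith
  next
    fix n w assume "w \<in> red_words N n"
    then have "card (next_letters N w) > 0" using card_next_letters[of w N n] N by auto
    then show "(\<Sum>z\<in>next_letters N w. ?d (w @ [z])) = 0"
      by (simp add: sum_subtractf cond_avg_def)
  qed
  then show ?thesis by (simp add: sum_subtractf)
qed

lemma bounded_over_n_tendsto_0:
  fixes x :: "nat \<Rightarrow> real"
  assumes "\<And>n. n \<ge> m \<Longrightarrow> \<bar>x n\<bar> \<le> K"
  shows "(\<lambda>n. x n / real n) \<longlonglongrightarrow> 0"
proof (rule Lim_null_comparison)
  show "(\<lambda>n. K / real n) \<longlonglongrightarrow> 0" by real_asymp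
  show "\<forall>\<^sub>F n in sequentially. norm (x n / real n) \<le> K / real n"
    using assms by (auto intro!: eventually_sequentiallyI[of m] divide_right_mono)
qed

text \<open>From index \<open>m\<close> on, the two sums differ by a fixed amount and the single
  term \<open>a (n - 1)\<close>. This compares averages over prefixes of lengths \<open>j\<close>
  and \<open>Suc j\<close>.\<close>

lemma shifted_averages_agree:
  fixes a b :: "nat \<Rightarrow> real"
  assumes shift: "\<And>j. j \<ge> m \<Longrightarrow> b (Suc j) = a j" and bound: "\<And>j. \<bar>a j\<bar> \<le> C"
  shows "(\<lambda>n. ((\<Sum>j<n. b j) - (\<Sum>j<n. a j)) / real n) \<longlonglongrightarrow> 0"
proof (rule bounded_over_n_tendsto_0)
  define D where "D = (\<Sum>j<Suc m. b j) - (\<Sum>j<m. a j)"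
  fix n assume n: "n \<ge> Suc m"
  have "(\<Sum>j<Suc k. b j) = (\<Sum>j<k. a j) + D" if "k \<ge> m" for k
    using that by (induction k rule: dec_induct) (simp_all add: D_def shift)
  from this[of "n - 1"] have "(\<Sum>j<n. b j) - (\<Sum>j<n. a j) = D - a (n - 1)"
    using n by (cases n) auto
  then show "\<bar>(\<Sum>j<n. b j) - (\<Sum>j<n. a j)\<bar> \<le> \<bar>D\<bar> + C"
    using bound[of "n - 1"] by linarith
qed

text \<open>On functions with mean zero the transition operator is \<open>h \<mapsto> - (h \<circ> linv) / (2 * N - 1)\<close>, so
  the averages of \<open>h\<close> and \<open>h \<circ> linv\<close> satisfy a nondegenerate linear system.\<close>

lemma letter_slln:
  fixes h :: "letter \<Rightarrow> real"
  assumes N: "N \<ge> 2" and bound: "\<And>x. \<bar>h x\<bar> \<le> C"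
  shows "AE y in nbw N. (\<lambda>n. (\<Sum>j<n. h (y j)) / real n) \<longlonglongrightarrow> (\<Sum>x\<in>letters N. h x) / (2 * real N)"
proof -
  define q where "q = 2 * real N - 1"
  have q: "q > 1" using N by (simp add: q_def)
  define T where "T = (\<Sum>x\<in>letters N. h x)"
  define A where "A h y n = (\<Sum>j<n. h (y j)) / real n" for h :: "letter \<Rightarrow> real" and y :: "nat \<Rightarrow> letter" and n
  have key: "AE y in nbw N. (\<lambda>n. A h y n + A (h \<circ> linv) y n / q) \<longlonglongrightarrow> T / q"
    if bound: "\<And>x. \<bar>h x\<bar> \<le> C" and T: "(\<Sum>x\<in>letters N. h x) = T" for h
  proof -
    let ?G = "\<lambda>w. h (last w)"
    have "AE y in nbw N. (\<lambda>n. ((\<Sum>j<n. ?G (map y [0..<Suc j])) - (\<Sum>j<n. cond_avg N ?G (map y [0..<j]))) / real n) \<longlonglongrightarrow> 0"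
      using N bound by (intro cond_avg_slln[of N ?G C]) auto
    moreover have "AE y in nbw N. \<forall>n. map y [0..<n] \<in> red_words N n"
      using N by (intro AE_prefix_red_words) auto
    ultimately show ?thesis
    proof eventually_elim
      case (elim y)
      let ?b = "\<lambda>j. cond_avg N ?G (map y [0..<j])" and ?c = "\<lambda>j. T / q - h (linv (y j)) / q"
      have red: "map y [0..<Suc j] \<in> red_words N (Suc j)" for j using elim(2) by blast
      \<comment> \<open>The letter after \<open>y j\<close> is uniform on all letters but
        \<open>linv (y j)\<close>, so the total \<open>T\<close> loses that one value and is divided
        by \<open>q\<close>.\<close>
      have cond: "?b (Suc j) = ?c j" for j
      proof -
        have yj: "y j \<in> letters N" using red[of j] by (auto simp: red_words_def)
        have "next_letters N (map y [0..<Suc j]) = letters N - {linv (y j)}"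
          by (simp add: next_letters_def)
        then show ?thesis
          using card_next_letters[OF red[of j]] yj N
          by (simp add: cond_avg_def sum_diff1 T q_def diff_divide_distrib of_nat_diff del: upt_Suc)
      qed
      have "\<bar>?c j\<bar> \<le> \<bar>T / q\<bar> + C / q" for j
      proof -
        have "\<bar>h (linv (y j)) / q\<bar> \<le> C / q"
          using bound[of "linv (y j)"] q by (simp add: divide_right_mono)
        then show ?thesis by linarith
      qed
      then have "(\<lambda>n. ((\<Sum>j<n. ?b j) - (\<Sum>j<n. ?c j)) / real n) \<longlonglongrightarrow> 0"
        using cond by (intro shifted_averages_agree) auto
      from tendsto_add[OF elim(1) this]
      have "(\<lambda>n. ((\<Sum>j<n. h (y j)) - (\<Sum>j<n. ?c j)) / real n) \<longlonglongrightarrow> 0"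
        by (simp add: diff_divide_distrib)
      from tendsto_add[OF this tendsto_const[of "T / q"]]
      have "(\<lambda>n. ((\<Sum>j<n. h (y j)) - (\<Sum>j<n. ?c j)) / real n + T / q) \<longlonglongrightarrow> T / q" by simp
      then show ?case
        by (rule Lim_transform_eventually)
           (use q in \<open>auto simp: A_def sum_subtractf sum_divide_distrib[symmetric] field_simps
             intro!: eventually_sequentiallyI[of 1]\<close>)
    qed
  qed
  \<comment> \<open>The total \<open>T\<close> is the same for \<open>h \<circ> linv\<close>, so
    \<open>key\<close> for that function is the second equation of the system.\<close>
  have "bij_betw linv (letters N) (letters N)"
    by (rule bij_betw_byWitness[of _ linv]) auto
  from sum.reindex_bij_betw[OF this, of h]
  have "AE y in nbw N. (\<lambda>n. A (h \<circ> linv) y n + A (h \<circ> linv \<circ> linv) y n / q) \<longlonglongrightarrow> T / q"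
    using bound by (intro key) (auto simp: T_def)
  moreover have "h \<circ> linv \<circ> linv = h" by auto
  ultimately have "AE y in nbw N. (\<lambda>n. A (h \<circ> linv) y n + A h y n / q) \<longlonglongrightarrow> T / q" by simp
  moreover have "AE y in nbw N. (\<lambda>n. A h y n + A (h \<circ> linv) y n / q) \<longlonglongrightarrow> T / q"
    using bound by (intro key) (auto simp: T_def)
  ultimately show ?thesis
  proof eventually_elim
    case (elim y)
    have "q\<^sup>2 > 1" using q by (simp add: one_less_power)
    then have "q\<^sup>2 \<noteq> 1" by (rule less_imp_neq[symmetric])
    then have q2: "1 - 1 / q\<^sup>2 \<noteq> 0" "q \<noteq> 0" "q\<^sup>2 \<noteq> 1"
      using q by auto
    \<comment> \<open>Elimination of \<open>A (h \<circ> linv)\<close>: the second equation divided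
      by \<open>q\<close> is subtracted from the first. The factor 1 - 1/q^2 that remains is nonzero
      as q > 1.\<close>
    have "(\<lambda>n. ((A h y n + A (h \<circ> linv) y n / q) - (A (h \<circ> linv) y n + A h y n / q) / q) / (1 - 1 / q\<^sup>2))
        \<longlonglongrightarrow> (T / q - T / q / q) / (1 - 1 / q\<^sup>2)"
      using q2 by (intro tendsto_intros elim) auto
    moreover have "((A h y n + A (h \<circ> linv) y n / q) - (A (h \<circ> linv) y n + A h y n / q) / q) / (1 - 1 / q\<^sup>2) = A h y n" for n
      using q2 by (simp add: divide_simps power2_eq_square) (simp add: algebra_simps)
    moreover have "(T / q - T / q / q) / (1 - 1 / q\<^sup>2) = T / (2 * real N)"
    proof -
      have "T / q - T / q / q = T / (q + 1) * (1 - 1 / q\<^sup>2)"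
        using q by (simp add: divide_simps power2_eq_square) (simp add: algebra_simps)
      then show ?thesis using q2 by (simp add: q_def)
    qed
    ultimately show ?case by (simp add: A_def T_def)
  qed
qed

text \<open>By truncated subtraction this is all of \<open>w\<close> when \<open>w\<close> has fewer
  than \<open>k\<close> letters, as happens for early prefixes of a trajectory.\<close>

definition last_n :: "nat \<Rightarrow> 'a list \<Rightarrow> 'a list" where
  "last_n k w = drop (length w - k) w"

lemma last_n_snoc: "last_n (Suc k) (w @ [z]) = last_n k w @ [z]"
  by (simp add: last_n_def)

text \<open>The conditional average over the last letter of a block is a function of the block one
  letter shorter, which leads down to single letters.\<close>

lemma block_slln:
  assumes N: "N \<ge> 2" and bound: "\<And>w. \<bar>G w\<bar> \<le> C"
  shows "\<exists>l. AE y in nbw N. (\<lambda>n. (\<Sum>j<n. G (last_n (Suc k) (map y [0..<Suc j]))) / real n) \<longlonglongrightarrow> l"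
  using bound
proof (induction k arbitrary: G)
  case 0
  have "last_n (Suc 0) (map y [0..<Suc j]) = [y j]" for y :: "nat \<Rightarrow> letter" and j
    by (simp add: last_n_snoc) (simp add: last_n_def)
  then show ?case using letter_slln[OF N, of "\<lambda>x. G [x]" C] 0 by auto
next
  case (Suc k)
  let ?G = "\<lambda>w. G (last_n (Suc (Suc k)) w)" and ?H = "\<lambda>w. cond_avg N G (last_n (Suc k) w)"
  \<comment> \<open>The next letter is constrained only by the last one, which a block of length
    \<open>Suc k\<close> retains.\<close>
  have H: "cond_avg N ?G w = ?H w" for w
  proof -
    have "next_letters N (last_n (Suc k) w) = next_letters N w"
      by (cases w rule: rev_cases) (auto simp: next_letters_def last_n_snoc, simp add: last_n_def)
    then show ?thesis by (simp add: cond_avg_def last_n_snoc)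
  qed
  obtain l where l: "AE y in nbw N. (\<lambda>n. (\<Sum>j<n. ?H (map y [0..<Suc j])) / real n) \<longlonglongrightarrow> l"
    using Suc.IH[of "cond_avg N G"] abs_cond_avg_le[of G C N, OF Suc.prems] by auto
  have "AE y in nbw N. (\<lambda>n. ((\<Sum>j<n. ?G (map y [0..<Suc j])) - (\<Sum>j<n. cond_avg N ?G (map y [0..<j]))) / real n) \<longlonglongrightarrow> 0"
    using N Suc.prems by (intro cond_avg_slln[of N ?G C]) auto
  then have "AE y in nbw N. (\<lambda>n. (\<Sum>j<n. ?G (map y [0..<Suc j])) / real n) \<longlonglongrightarrow> l"
    using l
  proof eventually_elim
    case (elim y)
    have "(\<lambda>n. ((\<Sum>j<n. ?H (map y [0..<j])) - (\<Sum>j<n. ?H (map y [0..<Suc j]))) / real n) \<longlonglongrightarrow> 0"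
      by (rule shifted_averages_agree[of 0 _ _ C]) (auto intro: abs_cond_avg_le Suc.prems)
    from tendsto_add[OF tendsto_add[OF elim(1)[unfolded H] this] elim(2)] show ?case
      by (simp add: diff_divide_distrib del: upt_Suc)
  qed
  then show ?case by blast
qed

section \<open>Overlap of a random word with its inverse\<close>

definition overlapping :: "nat \<Rightarrow> letter list set" where
  "overlapping m = {p @ v @ word_inv p | p v. length p = m}"

text \<open>The conjugator has half of \<open>length w - cyc_len w\<close> letters, hence at least
  \<open>m\<close>; its first \<open>m\<close> letters serve as \<open>p\<close>.\<close>

lemma overlapping_if_cyc_len:
  assumes "length w \<ge> cyc_len w + 2 * m"
  shows "w \<in> overlapping m"
proof -
  obtain u where u: "w = u @ cyc_core w @ word_inv u" using cyc_core_decomposition by blast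
  have "length w = 2 * length u + cyc_len w" using arg_cong[OF u, of length] by (simp add: cyc_len_def)
  then have "m \<le> length u" using assms by simp
  have "w = take m u @ (drop m u @ cyc_core w @ word_inv (drop m u)) @ word_inv (take m u)"
    by (subst u, subst (1 2) append_take_drop_id[of m u, symmetric]) (simp only: map_append rev_append append_assoc)
  moreover have "length (take m u) = m" using \<open>m \<le> length u\<close> by simp
  ultimately show ?thesis unfolding overlapping_def by blast
qed

text \<open>The last \<open>m\<close> letters of an overlapping word are dictated by its first
  \<open>m\<close>. So the prefix of length \<open>n - m\<close> determines the word, while it has
  \<open>(2 * N - 1) ^ m\<close> reduced extensions.\<close>

lemma word_avg_overlapping:
  assumes N: "N > 0"
  shows "word_avg N n (\<lambda>w. of_bool (w \<in> overlapping m)) \<le> 1 / (2 * real N - 1) ^ m"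
proof (cases "m = 0 \<or> red_words N n \<inter> overlapping m = {}")
  case True
  then show ?thesis
  proof
    assume "m = 0"
    have "word_avg N n (\<lambda>w. of_bool (w \<in> overlapping m)) \<le> word_avg N n (\<lambda>w. 0 * 0 + 1)"
      by (intro word_avg_mono) auto
    also have "\<dots> = 1" unfolding word_avg_affine[OF N] by simp
    finally show ?thesis using \<open>m = 0\<close> by simp
  next
    assume "red_words N n \<inter> overlapping m = {}"
    then have "word_avg N n (\<lambda>w. of_bool (w \<in> overlapping m)) = 0" by (simp add: word_avg_def)
    then show ?thesis using N by simp
  qed
next
  case False
  let ?O = "red_words N n \<inter> overlapping m"
  \<comment> \<open>An overlapping word has \<open>2 * m \<le> n\<close>. As \<open>m > 0\<close>,
    the shortened word is nonempty, so each added letter has exactly \<open>2 * N - 1\<close>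
    choices.\<close>
  from False have m: "n - m > 0" "n - m + m = n"
    by (auto simp: overlapping_def red_words_def)
  have "inj_on (take (n - m)) ?O"
  proof (rule inj_onI)
    fix w w' assume w: "w \<in> ?O" and w': "w' \<in> ?O" and eq: "take (n - m) w = take (n - m) w'"
    obtain p v p' v' where *: "w = p @ v @ word_inv p" "w' = p' @ v' @ word_inv p'" "length p = m" "length p' = m"
      using w w' by (auto simp: overlapping_def)
    then have "take (n - m) w = p @ v" "take (n - m) w' = p' @ v'"
      using w w' by (auto simp: red_words_def)
    then show "w = w'" using eq * by simp
  qed
  moreover have "take (n - m) ` ?O \<subseteq> red_words N (n - m)"
  proof
    fix u assume "u \<in> take (n - m) ` ?O"
    then obtain w where w: "w \<in> red_words N n" "u = take (n - m) w" by auto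
    then have "length u = n - m" "w = u @ drop (n - m) w"
      by (auto simp: red_words_def)
    moreover from this(2) obtain v where "w = u @ v" by blast
    ultimately show "u \<in> red_words N (n - m)"
      using w(1) by (auto simp: red_words_def successively_append_iff)
  qed
  ultimately have "card ?O \<le> card (red_words N (n - m))"
    by (rule card_inj_on_le) simp
  moreover have "card (red_words N n) = card (red_words N (n - m)) * (2 * N - 1) ^ m"
    using card_red_words_add[OF m(1), of N m] m(2) by simp
  moreover have "card (red_words N (n - m)) > 0" by (rule card_red_words_pos[OF N])
  moreover have "real ((2 * N - 1) ^ m) = (2 * real N - 1) ^ m" "(2 * real N - 1) ^ m > 0"
    using N by (auto simp: of_nat_diff)
  ultimately show ?thesis
    by (simp add: word_avg_def sum.inter_restrict[symmetric] of_bool_def flip: of_nat_power) (simp add: field_simps)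
qed

text \<open>Almost surely, cyclic reduction eventually removes only logarithmically many letters,
  since longer overlaps have summable probabilities.\<close>

lemma AE_cyc_len_prefix:
  assumes N: "N \<ge> 2"
  shows "AE y in nbw N. (\<lambda>n. (real n - real (cyc_len (map y [0..<n]))) / real n) \<longlonglongrightarrow> 0"
proof -
  \<comment> \<open>Base 3 is a lower bound for \<open>2 * N - 1\<close>, and the factor 2 makes
    \<open>3 ^ m n\<close> at least n^2.\<close>
  define m where "m n = nat \<lceil>2 * log 3 (real n)\<rceil>" for n
  have m: "1 / 3 ^ m n \<le> inverse ((real n)\<^sup>2)" if "n > 0" for n
  proof -
    have "(real n)\<^sup>2 = (3 powr log 3 (real n)) powr 2"
      using that by simp
    also have "\<dots> = 3 powr (2 * log 3 (real n))" by (simp only: powr_powr mult.commute)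
    also have "\<dots> \<le> 3 powr real (m n)"
      by (intro powr_mono) (auto simp: m_def real_nat_ceiling_ge)
    also have "\<dots> = 3 ^ m n" by (simp add: powr_realpow)
    finally show ?thesis using that by (simp add: inverse_eq_divide frac_le)
  qed
  have "AE y in nbw N. (\<lambda>n. of_bool (map y [0..<n] \<in> overlapping (m n)) :: real) \<longlonglongrightarrow> 0"
  proof (rule AE_prefix_tendsto_0[where F="\<lambda>n w. of_bool (w \<in> overlapping (m n))"])
    show "word_avg N n (\<lambda>w. of_bool (w \<in> overlapping (m n))) \<le> 1 / 3 ^ m n" for n
    proof -
      have "word_avg N n (\<lambda>w. of_bool (w \<in> overlapping (m n))) \<le> 1 / (2 * real N - 1) ^ m n"
        using N by (intro word_avg_overlapping) auto
      also have "\<dots> \<le> 1 / 3 ^ m n"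
        using N by (intro frac_le power_mono) auto
      finally show ?thesis .
    qed
    have "summable (\<lambda>n. inverse ((real n)\<^sup>2))"
      by (intro inverse_power_summable) simp
    then show "summable (\<lambda>n. 1 / 3 ^ m n :: real)"
      by (rule summable_comparison_test'[where N=1]) (use m in auto)
  qed (use N in auto)
  then show ?thesis
  proof (rule AE_mp, intro AE_I2 impI)
    fix y assume lim: "(\<lambda>n. of_bool (map y [0..<n] \<in> overlapping (m n)) :: real) \<longlonglongrightarrow> 0"
    \<comment> \<open>A sequence of zeros and ones with limit 0 is eventually 0.\<close>
    have "\<forall>\<^sub>F n in sequentially. of_bool (map y [0..<n] \<in> overlapping (m n)) < (1 :: real)"
      by (rule order_tendstoD(2)[OF lim]) simp
    then have ev: "\<forall>\<^sub>F n in sequentially. norm ((real n - real (cyc_len (map y [0..<n]))) / real n) \<le> (4 * log 3 (real n) + 2) / real n"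
      using eventually_gt_at_top[of 0]
    proof eventually_elim
      case (elim n)
      then have "\<not> n \<ge> cyc_len (map y [0..<n]) + 2 * m n"
        using overlapping_if_cyc_len[of "map y [0..<n]" "m n"] by auto
      moreover have "cyc_len (map y [0..<n]) \<le> n"
        using cyc_len_le_length[of "map y [0..<n]"] by simp
      moreover have "real (m n) \<le> 2 * log 3 (real n) + 1"
        using elim by (simp add: m_def)
      ultimately have "\<bar>real n - real (cyc_len (map y [0..<n]))\<bar> \<le> 4 * log 3 (real n) + 2" by linarith
      then show ?case by (simp add: divide_right_mono)
    qed
    have "(\<lambda>n. (4 * log 3 (real n) + 2) / real n) \<longlonglongrightarrow> 0" by real_asymp
    with ev show "(\<lambda>n. (real n - real (cyc_len (map y [0..<n]))) / real n) \<longlonglongrightarrow> 0"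
      by (rule Lim_null_comparison)
  qed
qed

section \<open>Existence of the generic stretching factor\<close>

lemma red_words_carrier: "w \<in> red_words N n \<longleftrightarrow> w \<in> carrier (free_group N) \<and> length w = n"
  by (auto simp: red_words_def carrier_free_group)

lemma last_n_split: "\<exists>u. w = u @ last_n k w"
  unfolding last_n_def by (metis append_take_drop_id)

lemma length_last_n: "k \<le> length w \<Longrightarrow> length (last_n k w) = k"
  by (simp add: last_n_def)

context free_group_auto
begin

text \<open>Past the first \<open>L\<close> letters, each increment of the length is a function of
  the last \<open>L + 1\<close> letters, so the block law applies to the telescoping sum.\<close>

lemma AE_length_f_converges:
  assumes N: "N \<ge> 2"
  obtains l where "AE y in nbw N. (\<lambda>n. real (length (f (map y [0..<n]))) / real n) \<longlonglongrightarrow> l"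
proof -
  obtain K K' where K: "\<And>w. w \<in> carrier (free_group N) \<Longrightarrow> length (f w) \<le> K * length w"
    and "\<And>w. w \<in> carrier (free_group N) \<Longrightarrow> length w \<le> K' * length (f w)"
    by (rule bi_lipschitz) (rule that)
  obtain L where L: "\<And>u v x. u @ v @ [x] \<in> carrier (free_group N) \<Longrightarrow> length v \<ge> L \<Longrightarrow>
    int (length (f (u @ v @ [x]))) - int (length (f (u @ v))) = int (length (f (v @ [x]))) - int (length (f v))"
    by (rule length_increment_local) (rule that)
  \<comment> \<open>The local increment, set to 0 off the reduced words of length
    \<open>L + 1\<close> because the block law asks for a bound on all lists.\<close>
  define G where "G v = (if v \<in> red_words N (Suc L) then real (length (f v)) - real (length (f (butlast v))) else 0)" for v
  have bound: "\<bar>G v\<bar> \<le> real (K * Suc L)" for v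
  proof (cases "v \<in> red_words N (Suc L)")
    case True
    then have v: "v \<in> carrier (free_group N)" "length v = Suc L" by (auto simp: red_words_carrier)
    then have "v = butlast v @ [last v]" by (cases v rule: rev_cases) auto
    then have b: "butlast v \<in> carrier (free_group N)" using v(1) carrier_appendD(1) by metis
    have "length (f v) \<le> K * Suc L" using K[OF v(1)] v(2) by simp
    moreover have "length (f (butlast v)) \<le> K * L" using K[OF b] v(2) by simp
    then have "length (f (butlast v)) \<le> K * Suc L" by simp
    ultimately have "real (length (f v)) \<le> real (K * Suc L)" "real (length (f (butlast v))) \<le> real (K * Suc L)"
      by (simp_all only: of_nat_le_iff)
    then show ?thesis using True by (simp add: G_def)
  qed (simp add: G_def)
  obtain l where l: "AE y in nbw N. (\<lambda>n. (\<Sum>j<n. G (last_n (Suc L) (map y [0..<Suc j]))) / real n) \<longlonglongrightarrow> l"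
    using block_slln[OF N, of G "real (K * Suc L)" L] bound by blast
  have "AE y in nbw N. \<forall>n. map y [0..<n] \<in> red_words N n"
    using N by (intro AE_prefix_red_words) auto
  with l have "AE y in nbw N. (\<lambda>n. real (length (f (map y [0..<n]))) / real n) \<longlonglongrightarrow> l"
  proof eventually_elim
    case (elim y)
    let ?a = "\<lambda>j. G (last_n (Suc L) (map y [0..<Suc j]))"
    let ?F = "\<lambda>n. real (length (f (map y [0..<n])))"
    have carr: "map y [0..<n] \<in> carrier (free_group N)" for n
      using elim(2) by (simp add: red_words_carrier)
    have local: "?F (Suc j) - ?F j = ?a j" if "j \<ge> L" for j
    proof -
      obtain u where u: "map y [0..<j] = u @ last_n L (map y [0..<j])" using last_n_split by blast
      define v where "v = last_n L (map y [0..<j])"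
      have v: "map y [0..<j] = u @ v" "length v = L" "last_n (Suc L) (map y [0..<Suc j]) = v @ [y j]"
        using u that by (simp_all add: v_def length_last_n last_n_snoc)
      have uv: "u @ v @ [y j] \<in> carrier (free_group N)" using carr[of "Suc j"] v(1) by simp
      have "v @ [y j] \<in> red_words N (Suc L)"
        using carrier_appendD(2)[OF uv] v(2) by (simp add: red_words_carrier)
      then have "?a j = real (length (f (v @ [y j]))) - real (length (f v))"
        by (simp only: G_def v(3) if_True butlast_snoc)
      also have "\<dots> = real (length (f (u @ v @ [y j]))) - real (length (f (u @ v)))"
        using L[OF uv] v(2) by linarith
      finally show ?thesis using v(1) by simp
    qed
    have "(\<lambda>n. (?F n - (\<Sum>j<n. ?a j)) / real n) \<longlonglongrightarrow> 0"
    proof (rule bounded_over_n_tendsto_0)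
      fix n assume "n \<ge> L"
      then have "?F n - (\<Sum>j<n. ?a j) = ?F L - (\<Sum>j<L. ?a j)"
      proof (induction n rule: dec_induct)
        case (step n)
        then show ?case using local[of n] by (simp del: upt_Suc)
      qed simp
      then show "\<bar>?F n - (\<Sum>j<n. ?a j)\<bar> \<le> \<bar>?F L - (\<Sum>j<L. ?a j)\<bar>" by simp
    qed
    from tendsto_add[OF this elim(1)] show ?case by (simp add: diff_divide_distrib)
  qed
  then show ?thesis by (rule that)
qed

text \<open>The gap between \<open>length (f w)\<close> and \<open>cyc_len (f w)\<close> is bounded
  by a constant plus a multiple of \<open>length w - cyc_len w\<close>, which is almost surely o(n).
  Since \<open>cyc_len w / n\<close> tends to 1, both quotients have the same limit.\<close>

lemma AE_cyc_len_f_converges: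
  assumes N: "N \<ge> 2"
  obtains l where "AE y in nbw N.
     (\<lambda>n. real (cyc_len (f (map y [0..<n]))) / real n) \<longlonglongrightarrow> l \<and>
     (\<lambda>n. real (cyc_len (f (map y [0..<n]))) / real (cyc_len (map y [0..<n]))) \<longlonglongrightarrow> l"
proof -
  obtain l where l: "AE y in nbw N. (\<lambda>n. real (length (f (map y [0..<n]))) / real n) \<longlonglongrightarrow> l"
    using AE_length_f_converges[OF N] .
  obtain B K where BK: "\<And>w. w \<in> carrier (free_group N) \<Longrightarrow>
    length (f w) \<le> cyc_len (f w) + 2 * B + K * (length w - cyc_len w)"
    by (rule cyc_len_f_lower) (rule that)
  have "AE y in nbw N. \<forall>n. map y [0..<n] \<in> red_words N n"
    using N by (intro AE_prefix_red_words) auto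
  with l AE_cyc_len_prefix[OF N] have "AE y in nbw N.
     (\<lambda>n. real (cyc_len (f (map y [0..<n]))) / real n) \<longlonglongrightarrow> l \<and>
     (\<lambda>n. real (cyc_len (f (map y [0..<n]))) / real (cyc_len (map y [0..<n]))) \<longlonglongrightarrow> l"
  proof eventually_elim
    case (elim y)
    let ?w = "\<lambda>n. map y [0..<n]"
    have "(\<lambda>n. (real (length (f (?w n))) - real (cyc_len (f (?w n)))) / real n) \<longlonglongrightarrow> 0"
    proof (rule Lim_null_comparison)
      show "\<forall>\<^sub>F n in sequentially. norm ((real (length (f (?w n))) - real (cyc_len (f (?w n)))) / real n)
        \<le> real (2 * B) / real n + real K * ((real n - real (cyc_len (?w n))) / real n)"
      proof (intro always_eventually allI)
        fix n
        have "?w n \<in> carrier (free_group N)" using elim(3) by (simp add: red_words_carrier)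
        then have "length (f (?w n)) \<le> cyc_len (f (?w n)) + 2 * B + K * (n - cyc_len (?w n))"
          using BK[of "?w n"] by simp
        then have "real (length (f (?w n))) \<le> real (cyc_len (f (?w n)) + 2 * B + K * (n - cyc_len (?w n)))"
          by (simp only: of_nat_le_iff)
        then have "real (length (f (?w n))) - real (cyc_len (f (?w n))) \<le> real (2 * B) + real K * (real n - real (cyc_len (?w n)))"
          using cyc_len_le_length[of "?w n"] by (simp add: of_nat_diff)
        moreover have "real (length (f (?w n))) - real (cyc_len (f (?w n))) \<ge> 0"
          using cyc_len_le_length[of "f (?w n)"] by simp
        ultimately have "norm ((real (length (f (?w n))) - real (cyc_len (f (?w n)))) / real n)
            \<le> (real (2 * B) + real K * (real n - real (cyc_len (?w n)))) / real n"
          by (simp add: divide_right_mono)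
        then show "norm ((real (length (f (?w n))) - real (cyc_len (f (?w n)))) / real n)
          \<le> real (2 * B) / real n + real K * ((real n - real (cyc_len (?w n))) / real n)"
          by (simp add: add_divide_distrib)
      qed
      have "(\<lambda>n. real (2 * B) / real n + real K * ((real n - real (cyc_len (?w n))) / real n)) \<longlonglongrightarrow> 0 + real K * 0"
        by (intro tendsto_intros elim(2) lim_const_over_n)
      then show "(\<lambda>n. real (2 * B) / real n + real K * ((real n - real (cyc_len (?w n))) / real n)) \<longlonglongrightarrow> 0"
        by simp
    qed
    from tendsto_diff[OF elim(1) this]
    have lim: "(\<lambda>n. real (cyc_len (f (?w n))) / real n) \<longlonglongrightarrow> l"
      by (simp add: diff_divide_distrib)
    have "(\<lambda>n. 1 - (real n - real (cyc_len (?w n))) / real n) \<longlonglongrightarrow> 1 - 0"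
      by (intro tendsto_intros elim(2))
    then have "(\<lambda>n. real (cyc_len (?w n)) / real n) \<longlonglongrightarrow> 1 - 0"
      by (rule Lim_transform_eventually)
         (auto simp: field_simps intro!: eventually_sequentiallyI[of 1])
    from tendsto_divide[OF lim this]
    have "(\<lambda>n. (real (cyc_len (f (?w n))) / real n) / (real (cyc_len (?w n)) / real n)) \<longlonglongrightarrow> l" by simp
    then have "(\<lambda>n. real (cyc_len (f (?w n))) / real (cyc_len (?w n))) \<longlonglongrightarrow> l"
      by (rule Lim_transform_eventually) (intro eventually_sequentiallyI[of 1], simp)
    with lim show ?case by blast
  qed
  then show ?thesis by (rule that)
qed

section \<open>Stretching factors in terms of a representative\<close>

abbreviation out_class :: "(letter list \<Rightarrow> letter list) set" where
  "out_class \<equiv> Inn (free_group N) #>\<^bsub>AutoGroup (free_group N)\<^esub> f"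

text \<open>Existence and uniqueness of the almost sure limit make the definite description in
  \<open>generic_stretch\<close> denote it.\<close>

lemma AE_generic_stretch:
  assumes N: "N \<ge> 2"
  shows "AE y in nbw N. (\<lambda>n. real (cyc_len (f (map y [0..<n]))) / real n) \<longlonglongrightarrow> generic_stretch N out_class"
proof -
  let ?P = "\<lambda>l y. (\<lambda>n. real (out_cyc_len out_class (map y [0..<n])) / real n) \<longlonglongrightarrow> l \<and>
     (\<lambda>n. real (out_cyc_len out_class (map y [0..<n])) / real (cyc_len (map y [0..<n]))) \<longlonglongrightarrow> l"
  obtain l where l: "AE y in nbw N.
     (\<lambda>n. real (cyc_len (f (map y [0..<n]))) / real n) \<longlonglongrightarrow> l \<and>
     (\<lambda>n. real (cyc_len (f (map y [0..<n]))) / real (cyc_len (map y [0..<n]))) \<longlonglongrightarrow> l"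
    using AE_cyc_len_f_converges[OF N] .
  have red: "AE y in nbw N. \<forall>n. map y [0..<n] \<in> red_words N n"
    using N by (intro AE_prefix_red_words) auto
  have P: "AE y in nbw N. ?P l y"
    using l red
  proof eventually_elim
    case (elim y)
    then have "out_cyc_len out_class (map y [0..<n]) = cyc_len (f (map y [0..<n]))" for n
      by (intro out_cyc_len_coset f) (simp add: red_words_carrier)
    then show ?case using elim(1) by simp
  qed
  have unique: "l' = l" if "AE y in nbw N. ?P l' y" for l'
  proof -
    interpret prob_space "nbw N" by (rule prob_space_nbw)
    \<comment> \<open>Under a probability measure, a statement free of \<open>y\<close> that holds
      almost surely is true.\<close>
    from that P have "AE y in nbw N. l' = l"
      by eventually_elim (blast intro: LIMSEQ_unique)
    then show ?thesis by (simp add: AE_const)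
  qed
  have "generic_stretch N out_class = l"
    unfolding generic_stretch_def
  proof (rule the_equality)
    show "AE y in nbw N. ?P l y" by (rule P)
  qed (rule unique)
  then show ?thesis using l by (auto elim: AE_mp)
qed

lemma generic_stretch_leI:
  assumes "N \<ge> 2"
    and "AE y in nbw N. g y \<longlonglongrightarrow> c"
    and "AE y in nbw N. \<forall>n. real (cyc_len (f (map y [0..<n]))) / real n \<le> g y n"
  shows "generic_stretch N out_class \<le> c"
proof -
  interpret prob_space "nbw N" by (rule prob_space_nbw)
  have "AE y in nbw N. generic_stretch N out_class \<le> c"
    using AE_generic_stretch[OF assms(1)] assms(2,3)
    by eventually_elim (rule LIMSEQ_le, auto)
  then show ?thesis by (simp add: AE_const)
qed

lemma generic_stretch_nonneg:
  assumes "N \<ge> 2"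
  shows "generic_stretch N out_class \<ge> 0"
proof -
  interpret prob_space "nbw N" by (rule prob_space_nbw)
  have "AE y in nbw N. generic_stretch N out_class \<ge> 0"
    using AE_generic_stretch[OF assms]
    by eventually_elim (rule LIMSEQ_le_const, auto)
  then show ?thesis by (simp add: AE_const)
qed

lemma le_extremal_stretch:
  assumes w: "w \<in> carrier (free_group N)" "w \<noteq> []"
  shows "real (cyc_len (f w)) / real (cyc_len w) \<le> extremal_stretch N out_class"
proof -
  obtain K where K: "\<And>w. w \<in> carrier (free_group N) \<Longrightarrow> cyc_len (f w) \<le> K * cyc_len w"
    by (rule cyc_len_f_upper) (rule that)
  have "bdd_above ((\<lambda>w. real (out_cyc_len out_class w) / real (cyc_len w)) ` (carrier (free_group N) - {[]}))"
  proof (rule bdd_aboveI2)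
    fix w assume "w \<in> carrier (free_group N) - {[]}"
    then have w: "w \<in> carrier (free_group N)" by blast
    have "real (cyc_len (f w)) \<le> real K * real (cyc_len w)"
      using K[OF w] by (metis of_nat_le_iff of_nat_mult)
    then show "real (out_cyc_len out_class w) / real (cyc_len w) \<le> real K"
      using out_cyc_len_coset[OF f w] by (cases "cyc_len w = 0") (simp_all add: divide_le_eq)
  qed
  from cSUP_upper[OF _ this, of w] show ?thesis
    using w out_cyc_len_coset[OF f w(1)] by (simp add: extremal_stretch_def)
qed

end

section \<open>Substitutions and transvections\<close>

text \<open>Images are given for inverse letters too; the map is a homomorphism once
  \<open>\<sigma>\<close> respects \<open>linv\<close>.\<close>

definition subst_word :: "(letter \<Rightarrow> letter list) \<Rightarrow> letter list \<Rightarrow> letter list" where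
  "subst_word \<sigma> w = free_reduce (concat (map \<sigma> w))"

lemma subst_word_append: "subst_word \<sigma> (u @ v) = free_reduce (subst_word \<sigma> u @ subst_word \<sigma> v)"
  by (simp add: subst_word_def)

lemma subst_word_Cons: "subst_word \<sigma> (x # w) = free_reduce (\<sigma> x @ subst_word \<sigma> w)"
  by (simp add: subst_word_def)

lemma free_reduce_cancel_inverse: "free_reduce (w @ word_inv w @ v) = free_reduce v"
proof -
  have "free_reduce (w @ word_inv w) = []"
    using free_reduce_inverse[of "word_inv w"] by (simp add: rev_map o_def)
  then show ?thesis
    using free_reduce_append_free_reduce(1)[of "w @ word_inv w" v] by simp
qed

text \<open>Free reduction deletes pairs \<open>x\<close>, \<open>linv x\<close>, and their images
  cancel as well.\<close>

lemma subst_word_free_reduce: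
  assumes "\<And>x. \<sigma> (linv x) = word_inv (\<sigma> x)"
  shows "subst_word \<sigma> (free_reduce w) = subst_word \<sigma> w"
proof (induction w)
  case (Cons x w)
  have push: "subst_word \<sigma> (push x v) = subst_word \<sigma> (x # v)" for v
    using assms free_reduce_cancel_inverse by (cases "(x, v)" rule: push.cases) (auto simp: subst_word_def)
  have "subst_word \<sigma> (free_reduce (x # w)) = subst_word \<sigma> (push x (free_reduce w))"
    by (simp add: free_reduce_def)
  then show ?case using Cons by (simp add: push subst_word_Cons)
qed (simp add: free_reduce_def)

lemma subst_word_inverse:
  assumes "\<And>x. \<tau> (linv x) = word_inv (\<tau> x)" "\<And>x. subst_word \<tau> (\<sigma> x) = [x]" "reduced_word w"
  shows "subst_word \<tau> (subst_word \<sigma> w) = w"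
  using assms(3)
proof (induction w)
  case (Cons x w)
  have "subst_word \<tau> (subst_word \<sigma> (x # w)) = free_reduce ([x] @ subst_word \<tau> (subst_word \<sigma> w))"
    using assms(1,2) by (simp add: subst_word_Cons subst_word_free_reduce subst_word_append)
  then show ?case using Cons reduced_Cons free_reduce_reduced by fastforce
qed (simp add: subst_word_def free_reduce_def)

lemma subst_word_carrier:
  assumes "\<And>x. x \<in> letters N \<Longrightarrow> \<sigma> x \<in> lists (letters N)" "w \<in> lists (letters N)"
  shows "subst_word \<sigma> w \<in> carrier (free_group N)"
proof -
  have "concat (map \<sigma> w) \<in> lists (letters N)" using assms by fastforce
  then show ?thesis
    using foldr_push_lists[of _ N "[]"] reduced_free_reduce
    by (simp add: carrier_free_group subst_word_def free_reduce_def)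
qed

text \<open>Substitutions that are inverse to each other on letters are inverse on all reduced
  words. The restriction makes the map extensional, as \<open>auto\<close> demands.\<close>

lemma subst_word_auto:
  assumes \<sigma>: "\<And>x. x \<in> letters N \<Longrightarrow> \<sigma> x \<in> lists (letters N)" "\<And>x. \<sigma> (linv x) = word_inv (\<sigma> x)"
    "\<And>x. subst_word \<tau> (\<sigma> x) = [x]"
    and \<tau>: "\<And>x. x \<in> letters N \<Longrightarrow> \<tau> x \<in> lists (letters N)" "\<And>x. \<tau> (linv x) = word_inv (\<tau> x)"
    "\<And>x. subst_word \<sigma> (\<tau> x) = [x]"
  shows "restrict (subst_word \<sigma>) (carrier (free_group N)) \<in> auto (free_group N)"
proof -
  interpret group "free_group N" by (rule group_free_group)
  have closed: "subst_word \<sigma> w \<in> carrier (free_group N)" "subst_word \<tau> w \<in> carrier (free_group N)"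
    if "w \<in> carrier (free_group N)" for w
  proof -
    have w: "w \<in> lists (letters N)" using that by (simp add: carrier_free_group)
    show "subst_word \<sigma> w \<in> carrier (free_group N)" using \<sigma>(1) w by (rule subst_word_carrier)
    show "subst_word \<tau> w \<in> carrier (free_group N)" using \<tau>(1) w by (rule subst_word_carrier)
  qed
  have "bij_betw (subst_word \<sigma>) (carrier (free_group N)) (carrier (free_group N))"
    using closed subst_word_inverse[OF \<tau>(2) \<sigma>(3)] subst_word_inverse[OF \<sigma>(2) \<tau>(3)]
    by (intro bij_betw_byWitness[of _ "subst_word \<tau>"]) (auto simp: carrier_free_group)
  moreover have "subst_word \<sigma> (u \<otimes>\<^bsub>free_group N\<^esub> v) = subst_word \<sigma> u \<otimes>\<^bsub>free_group N\<^esub> subst_word \<sigma> v" for u v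
    by (simp add: mult_free_group subst_word_free_reduce[of \<sigma>, OF \<sigma>(2)] subst_word_append)
  ultimately show ?thesis
    using closed by (auto simp: auto_def Bij_def hom_def)
qed

text \<open>The flag \<open>b\<close> is the sign of the exponent of the second generator, so
  \<open>b\<close> and \<open>\<not> b\<close> give mutually inverse substitutions.\<close>

definition transvection :: "nat \<Rightarrow> bool \<Rightarrow> letter \<Rightarrow> letter list" where
  "transvection k b x =
    (if x = (0, True) then (0, True) # replicate k (1, b)
     else if x = (0, False) then replicate k (1, \<not> b) @ [(0, False)] else [x])"

lemma length_transvection: "length (transvection k b x) = (if fst x = 0 then Suc k else 1)"
  by (cases x; cases "snd x") (auto simp: transvection_def)

lemma transvection_linv: "transvection k b (linv x) = word_inv (transvection k b x)"
  by (cases x; cases "snd x") (auto simp: transvection_def linv_def)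

lemma transvection_lists:
  "N \<ge> 2 \<Longrightarrow> x \<in> letters N \<Longrightarrow> transvection k b x \<in> lists (letters N)"
  by (auto simp: transvection_def letters_def)

text \<open>Powers of the second generator are fixed, so the block inserted by one transvection
  cancels against that of the other.\<close>

lemma transvection_inverse: "subst_word (transvection k (\<not> b)) (transvection k b x) = [x]"
proof -
  have fixed: "transvection k c (Suc 0, d) = [(Suc 0, d)]" for c d by (simp add: transvection_def)
  have concat_replicate: "concat (replicate m [z]) = replicate m z" for m and z :: letter
    by (induction m) auto
  have inv: "word_inv (replicate k (1, c)) = replicate k (1, \<not> c)" for c :: bool
    by (simp add: linv_def map_replicate_const)
  have cancel: "free_reduce (replicate k (1, c) @ replicate k (1, \<not> c) @ v) = free_reduce v" for c v
    using free_reduce_cancel_inverse[of "replicate k (1, c)" v] unfolding inv .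
  have cancel': "free_reduce (replicate k (1, \<not> c) @ replicate k (1, c) @ v) = free_reduce v" for c v
    using cancel[of "\<not> c" v] by simp
  consider "x = (0, True)" | "x = (0, False)" | "fst x \<noteq> 0" by (cases x; cases "snd x") auto
  then show ?thesis
  proof cases
    case 1
    have "subst_word (transvection k (\<not> b)) (transvection k b x)
        = free_reduce ([(0, True)] @ (replicate k (1, \<not> b) @ replicate k (1, b) @ []))"
      by (simp add: 1 subst_word_def fixed concat_replicate transvection_def[of _ _ "(0, _)"])
    also have "\<dots> = free_reduce ([(0, True)] @ free_reduce (replicate k (1, \<not> b) @ replicate k (1, b) @ []))"
      by (simp only: free_reduce_append_free_reduce)
    also have "\<dots> = [x]" by (simp only: cancel' 1) (simp add: free_reduce_def)
    finally show ?thesis .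
  next
    case 2
    have "subst_word (transvection k (\<not> b)) (transvection k b x)
        = free_reduce (replicate k (1, \<not> b) @ replicate k (1, b) @ [(0, False)])"
      by (simp add: 2 subst_word_def fixed concat_replicate transvection_def[of _ _ "(0, _)"])
    also have "\<dots> = [x]" by (simp only: cancel' 2) (simp add: free_reduce_def)
    finally show ?thesis .
  next
    case 3
    then show ?thesis by (cases x) (simp add: transvection_def subst_word_def free_reduce_def)
  qed
qed

lemma transvection_auto:
  assumes "N \<ge> 2"
  shows "restrict (subst_word (transvection k True)) (carrier (free_group N)) \<in> auto (free_group N)"
  using transvection_lists[OF assms] transvection_linv transvection_inverse[of k True] transvection_inverse[of k False]
  by (intro subst_word_auto[where \<tau>="transvection k False"]) simp_all

lemma sum_length_transvection:
  assumes "N > 0"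
  shows "(\<Sum>x\<in>letters N. real (length (transvection k b x))) = 2 * (real N + real k)"
proof -
  have "(\<Sum>x\<in>letters N. real (length (transvection k b x)))
      = (\<Sum>i<N. \<Sum>c\<in>(UNIV::bool set). 1 + (if i = 0 then real k else 0))"
    unfolding letters_def length_transvection
    by (simp only: sum.cartesian_product) (auto intro!: sum.cong)
  also have "\<dots> = 2 * (real N + real k)"
    using assms by (simp add: UNIV_bool sum.distrib flip: sum_distrib_left)
  finally show ?thesis .
qed

section \<open>Bounds for the infimum\<close>

text \<open>The transvection with exponent \<open>N\<close> is the witness; \<open>bdd\<close> makes
  the real infimum a lower bound for its ratio.\<close>

lemma rho_upper:
  assumes N: "N \<ge> 2" and bdd: "bdd_below ((\<lambda>\<phi>. generic_stretch N \<phi> / extremal_stretch N \<phi>) ` carrier (Out (free_group N)))"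
  shows "rho N \<le> 2 / (real N + 1)"
proof -
  define f where "f = restrict (subst_word (transvection N True)) (carrier (free_group N))"
  interpret free_group_auto N f
    unfolding f_def by unfold_locales (rule transvection_auto[OF N])
  let ?h = "\<lambda>x. real (length (transvection N True x))"
  have "generic_stretch N out_class \<le> (\<Sum>x\<in>letters N. ?h x) / (2 * real N)"
  proof (rule generic_stretch_leI[OF N letter_slln[OF N]])
    show "\<bar>?h x\<bar> \<le> real (Suc N)" for x by (simp add: length_transvection)
    have "AE y in nbw N. \<forall>n. map y [0..<n] \<in> red_words N n"
      using N by (intro AE_prefix_red_words) auto
    then show "AE y in nbw N. \<forall>n. real (cyc_len (f (map y [0..<n]))) / real n \<le> (\<Sum>j<n. ?h (y j)) / real n"
    proof (rule AE_mp, intro AE_I2 impI allI)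
      fix y n assume "\<forall>n. map y [0..<n] \<in> red_words N n"
      then have "f (map y [0..<n]) = subst_word (transvection N True) (map y [0..<n])"
        by (simp add: f_def red_words_carrier)
      \<comment> \<open>Before free reduction the length is additive over the letters, so the law
        for single letters applies.\<close>
      then have "cyc_len (f (map y [0..<n])) \<le> length (concat (map (transvection N True) (map y [0..<n])))"
        using cyc_len_le_length length_free_reduce order_trans unfolding subst_word_def by metis
      also have "\<dots> = (\<Sum>j<n. length (transvection N True (y j)))"
        by (simp add: length_concat o_def interv_sum_list_conv_sum_set_nat atLeast0LessThan)
      finally have "real (cyc_len (f (map y [0..<n]))) \<le> (\<Sum>j<n. ?h (y j))"
        by (simp only: of_nat_le_iff flip: of_nat_sum)
      then show "real (cyc_len (f (map y [0..<n]))) / real n \<le> (\<Sum>j<n. ?h (y j)) / real n"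
        by (rule divide_right_mono) simp
    qed
  qed
  \<comment> \<open>With exponent \<open>N\<close> the mean image length of a letter is
    \<open>2 * (N + N) / (2 * N)\<close>.\<close>
  also have "\<dots> = 2" using N by (simp add: sum_length_transvection)
  finally have generic: "generic_stretch N out_class \<le> 2" .
  have a0: "[(0, True)] \<in> carrier (free_group N)" using N by (simp add: carrier_free_group letters_def)
  have "f [(0, True)] = (0, True) # replicate N (1, True)"
  proof -
    have "reduced_word (replicate k (1, True))" for k
      by (induction k) (auto simp: successively_Cons linv_def)
    then have "reduced_word ((0, True) # replicate N (1, True))"
      using N by (auto simp: successively_Cons linv_def)
    then show ?thesis using a0 by (simp add: f_def subst_word_def transvection_def free_reduce_reduced)
  qed
  \<comment> \<open>The first and last letters belong to different generators, so the word is
    cyclically reduced.\<close>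
  moreover have "cyc_len ((0, True) # replicate N (1, True)) = Suc N"
    using N by (simp add: cyc_len_def, subst cyc_core.simps) (auto simp: linv_def)
  moreover have "cyc_len [(0, True)] = 1" by (simp add: cyc_len_def cyc_core.simps)
  ultimately have extremal: "extremal_stretch N out_class \<ge> real N + 1"
    using le_extremal_stretch[OF a0] by simp
  have "out_class \<in> carrier (Out (free_group N))"
    using f by (auto simp: Out_def FactGroup_def RCOSETS_def AutoGroup_def)
  then have "rho N \<le> generic_stretch N out_class / extremal_stretch N out_class"
    unfolding rho_def by (rule cINF_lower[OF bdd])
  also have "\<dots> \<le> 2 / (real N + 1)"
    using generic extremal generic_stretch_nonneg[OF N] by (intro frac_le) auto
  finally show ?thesis .
qed

text \<open>This bounds the infimum from below and supplies the boundedness that the upper estimate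
  asks for.\<close>

lemma stretch_ratio_nonneg:
  assumes N: "N \<ge> 2" and \<phi>: "\<phi> \<in> carrier (Out (free_group N))"
  shows "generic_stretch N \<phi> / extremal_stretch N \<phi> \<ge> 0"
proof -
  obtain f where g: "f \<in> auto (free_group N)" "\<phi> = Inn (free_group N) #>\<^bsub>AutoGroup (free_group N)\<^esub> f"
    using \<phi> by (auto simp: Out_def FactGroup_def RCOSETS_def AutoGroup_def)
  interpret free_group_auto N f by unfold_locales (rule g)
  have "[(0, True)] \<in> carrier (free_group N)" using N by (simp add: carrier_free_group letters_def)
  from le_extremal_stretch[OF this] have "extremal_stretch N \<phi> \<ge> 0"
    unfolding g(2) by (rule order_trans[rotated]) simp_all
  then show ?thesis using generic_stretch_nonneg[OF N] unfolding g(2) by simp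
qed

lemma rho_bounds:
  assumes N: "N \<ge> 2"
  shows "0 \<le> rho N" "rho N \<le> 2 / (real N + 1)"
proof -
  have "carrier (Out (free_group N)) \<noteq> {}"
    using transvection_auto[OF N] by (auto simp: Out_def FactGroup_def RCOSETS_def AutoGroup_def)
  then show "0 \<le> rho N"
    unfolding rho_def using stretch_ratio_nonneg[OF N] by (rule cINF_greatest)
  show "rho N \<le> 2 / (real N + 1)"
    by (rule rho_upper[OF N], rule bdd_belowI2) (rule stretch_ratio_nonneg[OF N])
qed

theorem proposition7p1:
  shows "rho \<longlonglongrightarrow> 0
    \<and> rho \<in> O(\<lambda>N. 1 / real N)
    \<and> limsup (\<lambda>N. ereal (real N * rho N)) < \<infinity>"
proof -
  have ev: "\<forall>\<^sub>F N in sequentially. 0 \<le> rho N \<and> rho N \<le> 2 / (real N + 1) \<and> N > 0"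
    using rho_bounds by (auto intro!: eventually_sequentiallyI[of 2])
  have "rho \<longlonglongrightarrow> 0"
  proof (rule tendsto_sandwich[of "\<lambda>_. 0" rho _ "\<lambda>N. 2 / (real N + 1)"])
    show "(\<lambda>N. 2 / (real N + 1)) \<longlonglongrightarrow> 0" by real_asymp
  qed (use ev in \<open>auto elim: eventually_mono\<close>)
  moreover have "rho \<in> O(\<lambda>N. 1 / real N)"
  proof (rule bigoI)
    show "\<forall>\<^sub>F N in sequentially. norm (rho N) \<le> 2 * norm (1 / real N)"
      using ev
    proof eventually_elim
      case (elim N)
      then have "2 / (real N + 1) \<le> 2 / real N" by (intro frac_le) auto
      then show ?case using elim by simp
    qed
  qed
  moreover have "limsup (\<lambda>N. ereal (real N * rho N)) \<le> ereal 2"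
  proof (rule Limsup_bounded)
    show "\<forall>\<^sub>F N in sequentially. ereal (real N * rho N) \<le> ereal 2"
      using ev
    proof eventually_elim
      case (elim N)
      then have "real N * rho N \<le> real N * (2 / (real N + 1))" by (intro mult_left_mono) auto
      also have "\<dots> \<le> 2" by (simp add: field_simps)
      finally show ?case by simp
    qed
  qed
  then have "limsup (\<lambda>N. ereal (real N * rho N)) < \<infinity>"
    by (rule order_le_less_trans) simp
  ultimately show ?thesis by blast
qed

end
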